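(* Let $p$ be an odd prime and $n$ odd. For each $0\le k\le p-1$ let $c_k\in\mathbb{F}_p^*$ and let $g_k(x)=c_k\mathrm{Tr}_n(x^{p^{r_k}+1}-x^{p^{t_k}+1})$ with integers $r_k>t_k\ge0$ satisfying $\gcd(n,r_k+t_k)=\gcd(n,r_k-t_k)=\gcd(n,p)=1$ (so each $g_k$ is near-bent and its linearized polynomial has kernel $\mathbb{F}_p$). Let $b_0,\ldots,b_{p-1}\in\mathbb{F}_{p^n}$ satisfy $g_k(1)+\mathrm{Tr}_n(b_k)=g_0(1)+k$, put $f_k(x)=g_k(x)+\mathrm{Tr}_n(b_kx)$, and \[F(x,y)=(p-1)\sum_{k=0}^{p-1}\Big(\prod_{j\in\mathbb{F}_p,j\ne k}(y-j)\Big)f_k(x).\] Then $F:\mathbb{F}_{p^n}\times\mathbb{F}_p\to\mathbb{F}_p$ is a weakly regular bent function.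
   Context: $\epsilon_p=e^{2\pi i/p}$, $\mathrm{Tr}_n$ the absolute trace $\mathbb{F}_{p^n}\to\mathbb{F}_p$; for $F$ on $\mathbb{F}_{p^n}\times\mathbb{F}_p$, $\widehat F(a,b)=\sum_{x,y}\epsilon_p^{F(x,y)-\mathrm{Tr}_n(ax)-by}$. A bent function $F$ on an $m$-dimensional space ($|\widehat F(w)|^2=p^m$ for all $w$) is weakly regular if there is a complex $\zeta$ with $|\zeta|=1$ and a function $F^*$ into $\mathbb{F}_p$ with $p^{-m/2}\widehat F(w)=\zeta\,\epsilon_p^{F^*(w)}$ for all $w$. *)

theory Defs
  imports "HOL-Analysis.Analysis"
begin

text \<open>The field F_{p^n} is modelled by a finite field type 'a with CARD('a) = p^n;
  F_p is its prime subfield, whose elements are of_nat k for k < p.\<close>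

definition Tr :: "nat \<Rightarrow> nat \<Rightarrow> 'a::field \<Rightarrow> 'a" where
  "Tr p n x = (\<Sum>i<n. x ^ (p ^ i))"

definition fp_val :: "nat \<Rightarrow> 'a::field \<Rightarrow> nat" where
  "fp_val p t = (THE k. k < p \<and> of_nat k = t)"

definition eps :: "nat \<Rightarrow> int \<Rightarrow> complex" where
  "eps p k = cis (2 * pi * of_int k / real p)"

definition walsh :: "nat \<Rightarrow> nat \<Rightarrow> ('a::{field,finite} \<Rightarrow> 'a \<Rightarrow> 'a) \<Rightarrow> 'a \<Rightarrow> nat \<Rightarrow> complex" where
  "walsh p n F a b = (\<Sum>x\<in>(UNIV::'a set). \<Sum>y<p.
      eps p (int (fp_val p (F x (of_nat y) - Tr p n (a * x) - of_nat b * of_nat y))))"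

definition is_bent :: "nat \<Rightarrow> nat \<Rightarrow> ('a::{field,finite} \<Rightarrow> 'a \<Rightarrow> 'a) \<Rightarrow> bool" where
  "is_bent p n F \<longleftrightarrow> (\<forall>a. \<forall>b<p. (cmod (walsh p n F a b))^2 = real p ^ (n + 1))"

definition weakly_regular_bent :: "nat \<Rightarrow> nat \<Rightarrow> ('a::{field,finite} \<Rightarrow> 'a \<Rightarrow> 'a) \<Rightarrow> bool" where
  "weakly_regular_bent p n F \<longleftrightarrow> is_bent p n F \<and>
     (\<exists>\<zeta> Fs. cmod \<zeta> = 1 \<and> (\<forall>a. \<forall>b<p. Fs a b < p \<and>
        walsh p n F a b / complex_of_real (sqrt (real p) ^ (n + 1)) = \<zeta> * eps p (int (Fs a b))))"

end

theory Submission
  imports Defs "HOL-Number_Theory.Residues" "HOL-Library.Real_Mod"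
begin

text \<open>
  Interpolation gives \<open>F(x, y) = f\<^sub>y(x)\<close>, so the Walsh sum splits into the sums of the quadratic
  forms \<open>g\<^sub>y\<close> at \<open>a - b\<^sub>y\<close>. The radical of every \<open>g\<^sub>y\<close> is \<open>F\<^sub>p\<close> and \<open>Tr(b\<^sub>y) = y\<close>, so only
  \<open>y = Tr(a)\<close> contributes, and completing the square there leaves a power of \<open>\<epsilon>\<^sub>p\<close> times
  \<open>S\<^sub>y = \<Sum>\<^sub>x \<epsilon>\<^sub>p^g\<^sub>y(x)\<close>.

  The form \<open>g\<^sub>y\<close> has even rank \<open>n - 1\<close>, and \<open>S\<^sub>y\<close> is an integer with square \<open>p^(n+1)\<close>. Weak regularity
  amounts to its sign being independent of \<open>y\<close>, which is proved by induction over the divisors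
  \<open>d\<close> of \<open>n\<close>: for a prime \<open>l\<close> dividing \<open>d\<close> the Frobenius power \<open>x \<mapsto> x^(p^(d/l))\<close> acts on the
  field with \<open>p^d\<close> elements with orbits of size 1 or \<open>l\<close> and preserves the form, so modulo \<open>l\<close> the
  integer is the one belonging to the field with \<open>p^(d/l)\<close> elements. As \<open>l\<close> is odd and different
  from \<open>p\<close>, this congruence determines the sign.
\<close>

section \<open>Fixed points and roots\<close>

lemma funpow_fixed_mult: "(f ^^ k) x = x \<Longrightarrow> (f ^^ (k * i)) x = x"
  by (induction i) (auto simp: funpow_add)

text \<open>This is Euclid's algorithm on exponents: once \<open>f ^^ b\<close> fixes
  \<open>x\<close>, so does \<open>f ^^ (a mod b)\<close>. For the Frobenius map it says that two
  fixed fields intersect in the one of the gcd.\<close>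

lemma funpow_fixed_gcd:
  assumes "(f ^^ a) x = x" and "(f ^^ b) x = x"
  shows "(f ^^ gcd a b) x = x"
  using assms
proof (induction a b rule: gcd_nat_induct)
  case (step a b)
  have "(f ^^ (a mod b + b * (a div b))) x = x"
    using step.prems by simp
  then have "(f ^^ (a mod b)) x = x"
    using funpow_fixed_mult[OF step.prems(2)] by (simp only: funpow_add o_apply)
  with step.IH step.prems(2) show ?case by (subst gcd_red_nat) blast
qed simp

text \<open>Every non-fixed point lies on an orbit of exactly \<open>l\<close> elements. Removing
  that orbit leaves a smaller invariant set with the same fixed points, so induction on the size
  applies.\<close>

lemma cong_card_fixed_points:
  fixes f :: "'b \<Rightarrow> 'b"
  assumes "prime l" "finite A" "f ` A \<subseteq> A" "\<And>x. x \<in> A \<Longrightarrow> (f ^^ l) x = x"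
  shows "[card A = card {x\<in>A. f x = x}] (mod l)"
  using assms(2-4)
proof (induction "card A" arbitrary: A rule: less_induct)
  case less
  show ?case
  proof (cases "\<forall>x\<in>A. f x = x")
    case True
    then have "{x\<in>A. f x = x} = A" by auto
    then show ?thesis by simp
  next
    case False
    then obtain x where x: "x \<in> A" "f x \<noteq> x" by blast
    have "l > 0" using assms(1) prime_gt_0_nat by blast
    define X where "X = (\<lambda>i. (f ^^ i) x) ` {..<l}"
    have fA: "(f ^^ i) y \<in> A" if "y \<in> A" for i y
      using that less.prems(2) by (induction i) auto
    have xl: "(f ^^ l) x = x" using less.prems(3) x by blast
    have mod_l: "(f ^^ i) x = (f ^^ (i mod l)) x" for i
    proof -
      have "(f ^^ i) x = (f ^^ (i mod l + l * (i div l))) x" by simp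
      also have "\<dots> = (f ^^ (i mod l)) x"
        by (simp only: funpow_add o_apply funpow_fixed_mult[OF xl])
      finally show ?thesis .
    qed
    \<comment> \<open>The orbit returns to \<open>x\<close> after \<open>l\<close> steps, so a fixed
      point on it would have to be \<open>x\<close> itself.\<close>
    have nonfix: "f y \<noteq> y" if yX: "y \<in> X" for y
    proof
      assume "f y = y"
      then have fixd: "(f ^^ i) y = y" for i by (induction i) auto
      obtain i where i: "i < l" "y = (f ^^ i) x" using yX by (auto simp: X_def)
      have "x = (f ^^ (l - i)) y"
        using i xl by (simp add: funpow_add[symmetric, THEN fun_cong, unfolded o_apply])
      then have "y = x" using fixd by simp
      then show False using \<open>f y = y\<close> x by simp
    qed
    \<comment> \<open>A repetition would make both \<open>j - i\<close> and the prime
      \<open>l\<close> periods of one point; these are coprime, so the point would be fixed.\<close>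
    have inj: "inj_on (\<lambda>i. (f ^^ i) x) {..<l}"
    proof (rule linorder_inj_onI)
      fix i j assume ij: "i < j" "i \<in> {..<l}" "j \<in> {..<l}"
      show "(f ^^ i) x \<noteq> (f ^^ j) x"
      proof
        assume eq: "(f ^^ i) x = (f ^^ j) x"
        let ?y = "(f ^^ i) x"
        have "(f ^^ (j - i)) ?y = (f ^^ (j - i + i)) x" by (simp only: funpow_add o_apply)
        then have "(f ^^ (j - i)) ?y = ?y" using eq ij by simp
        moreover have "(f ^^ l) ?y = ?y" using fA x less.prems(3) by blast
        ultimately have "(f ^^ gcd (j - i) l) ?y = ?y" by (rule funpow_fixed_gcd)
        moreover have "coprime l (j - i)"
          using assms(1) ij by (intro prime_imp_coprime) (auto dest: dvd_imp_le)
        ultimately have "f ?y = ?y" by (subst (asm) gcd.commute) simp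
        then show False using nonfix[of ?y] ij by (auto simp: X_def)
      qed
    qed auto
    have cX: "card X = l" by (simp add: X_def card_image inj)
    have XA: "X \<subseteq> A" using fA x by (auto simp: X_def)
    have fX: "f y \<in> X \<longleftrightarrow> y \<in> X" if "y \<in> A" for y
    proof
      assume "y \<in> X"
      then obtain i where i: "y = (f ^^ i) x" by (auto simp: X_def)
      then have "f y = (f ^^ (Suc i mod l)) x" using mod_l[of "Suc i"] by simp
      then show "f y \<in> X" using \<open>l > 0\<close> by (auto simp: X_def)
    next
      assume "f y \<in> X"
      then obtain i where i: "f y = (f ^^ i) x" by (auto simp: X_def)
      have "y = (f ^^ (l - 1)) (f y)"
        using less.prems(3)[OF \<open>y \<in> A\<close>] \<open>l > 0\<close>
          funpow_Suc_right[of "l - 1" f, THEN fun_cong, of y] by simp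
      then have "y = (f ^^ (l - 1 + i)) x" using i by (simp add: funpow_add)
      then have "y = (f ^^ ((l - 1 + i) mod l)) x" using mod_l[of "l - 1 + i"] by simp
      then show "y \<in> X" using \<open>l > 0\<close> by (auto simp: X_def)
    qed
    have fin: "finite X" by (simp add: X_def)
    have card: "card A = card (A - X) + l"
      using card_Diff_subset[OF fin XA] card_mono[OF less.prems(1) XA] cX by simp
    have "[card (A - X) = card {y\<in>A - X. f y = y}] (mod l)"
    proof (rule less.hyps)
      show "card (A - X) < card A" using card \<open>l > 0\<close> by simp
      show "f ` (A - X) \<subseteq> A - X" using fX less.prems(2) by auto
    qed (use less.prems in auto)
    moreover have "{y\<in>A - X. f y = y} = {y\<in>A. f y = y}" using nonfix by auto
    ultimately show ?thesis using card by (simp add: cong_def)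
  qed
qed

lemma card_roots_le:
  fixes P :: "'a::idom poly"
  assumes "degree P \<le> k" "P \<noteq> 0" "\<And>x. x \<in> A \<Longrightarrow> poly P x = 0"
  shows "card A \<le> k"
proof -
  have "card A \<le> card {x. poly P x = 0}"
    by (rule card_mono) (use assms poly_roots_finite in auto)
  also have "\<dots> \<le> k" using card_poly_roots_bound[OF assms(2)] assms(1) by simp
  finally show ?thesis .
qed

text \<open>The fibre is the root set of a nonzero polynomial of degree \<open>q ^ (k - 1)\<close>.
  With \<open>q\<close> a power of \<open>p\<close> the sum is a trace, so this bounds the fibres of
  relative and absolute traces.\<close>

lemma card_power_sum_fibre_le:
  fixes y :: "'a::field"
  assumes "q \<ge> 2" "k > 0"
  shows "card {x. (\<Sum>i<k. x ^ (q ^ i)) = y} \<le> q ^ (k - 1)"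
proof -
  define P :: "'a poly" where "P = (\<Sum>i<k. Polynomial.monom 1 (q ^ i)) - [:y:]"
  obtain j where j: "k = Suc j" using assms by (cases k) auto
  have "Polynomial.coeff P (q ^ j) = 1"
  proof -
    have "Polynomial.coeff P (q ^ j) = (\<Sum>i<k. if q ^ i = q ^ j then 1 else 0)"
      unfolding P_def Polynomial.coeff_diff Polynomial.coeff_sum Polynomial.coeff_monom
      using assms by (subst Polynomial.coeff_eq_0[of "[:y:]"]) auto
    also have "\<dots> = (\<Sum>i<k. if i = j then 1 else 0)"
      using assms by (intro sum.cong) auto
    finally show ?thesis using j by simp
  qed
  moreover have "degree P \<le> q ^ j"
    unfolding P_def
  proof (intro degree_diff_le degree_sum_le)
    fix i assume "i \<in> {..<k}"
    then show "degree (Polynomial.monom (1::'a) (q ^ i)) \<le> q ^ j"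
      using assms j by (intro order.trans[OF Polynomial.degree_monom_le] power_increasing) auto
  qed auto
  moreover from calculation have "P \<noteq> 0" by auto
  ultimately show ?thesis
    unfolding j diff_Suc_1
    by (intro card_roots_le[of P]) (auto simp: P_def j poly_sum poly_monom)
qed

section \<open>Fields of odd characteristic\<close>

text \<open>Multiplication by a nonzero \<open>x\<close> permutes the nonzero elements; comparing
  their products gives \<open>x ^ (CARD('a) - 1) = 1\<close>.\<close>

lemma finite_field_power_card:
  fixes x :: "'a::{field,finite}"
  shows "x ^ CARD('a) = x"
proof (cases "x = 0")
  case False
  have "(\<Prod>y\<in>UNIV-{0}. x * y) = (\<Prod>y\<in>UNIV-{0::'a}. y)"
    by (rule prod.reindex_bij_witness[where i = "\<lambda>y. y / x" and j = "\<lambda>y. x * y"]) (use False in auto)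
  then have "x ^ (CARD('a) - 1) = 1"
    by (simp add: prod.distrib card_Diff_singleton)
  then have "x ^ (CARD('a) - 1) * x = x" by simp
  then show ?thesis by (subst (asm) power_minus_mult) simp_all
qed (simp add: zero_power)

lemma card_power_fixed_le:
  assumes "q \<ge> 2"
  shows "card {x::'a::field. x ^ q = x} \<le> q"
proof -
  define P :: "'a poly" where "P = Polynomial.monom 1 q - [:0, 1:]"
  have "Polynomial.coeff P q = 1"
    using assms unfolding P_def by (simp add: Polynomial.coeff_eq_0)
  moreover have "degree P \<le> q"
    using assms unfolding P_def by (intro degree_diff_le Polynomial.degree_monom_le) auto
  moreover from calculation have "P \<noteq> 0" by auto
  ultimately show ?thesis
    by (intro card_roots_le[of P]) (auto simp: P_def poly_monom)
qed

lemma card_fibres: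
  assumes "finite A" "finite B" "f ` A \<subseteq> B"
  shows "card A = (\<Sum>y\<in>B. card {x\<in>A. f x = y})"
  using sum.group[OF assms, of "\<lambda>_. 1 :: nat"] by simp

locale odd_char =
  fixes p :: nat
  assumes prime_p: "prime p" and odd_p: "odd p" and char_p: "CHAR('a::{field,finite}) = p"
begin

definition Fp :: "'a set" where "Fp = range of_nat"

text \<open>For \<open>d\<close> dividing the degree of the field this is the subfield with
  \<open>p^d\<close> elements. Allowing every \<open>d\<close> lets \<open>K (r + t)\<close> and
  \<open>K (r - t)\<close> stand for the kernels of the two factors in
  \<open>radical_polar\<close>.\<close>

definition K :: "nat \<Rightarrow> 'a set" where "K d = {x. x ^ (p ^ d) = x}"

text \<open>The canonical additive character of the prime field. It is meaningful only on
  \<open>Fp\<close>, hence the many membership side conditions below.\<close>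

definition ch :: "'a \<Rightarrow> complex" where "ch t = eps p (int (fp_val p t))"

definition subspace_Fp :: "'a set \<Rightarrow> bool" where
  "subspace_Fp V \<longleftrightarrow> 0 \<in> V \<and> (\<forall>x\<in>V. \<forall>y\<in>V. x + y \<in> V) \<and> (\<forall>a\<in>Fp. \<forall>x\<in>V. a * x \<in> V)"

text \<open>Over a prime field an additive map is linear, so homogeneity is not listed.\<close>

definition linear_Fp :: "'a set \<Rightarrow> ('a \<Rightarrow> 'a) \<Rightarrow> bool" where
  "linear_Fp V l \<longleftrightarrow> (\<forall>x\<in>V. l x \<in> Fp) \<and> (\<forall>x\<in>V. \<forall>y\<in>V. l (x + y) = l x + l y)"

section \<open>Arithmetic of the prime field\<close>

lemma p_gt_2: "p > 2"
  using prime_ge_2_nat[OF prime_p] odd_p by (cases "p = 2") auto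

lemma of_nat_eq_0: "(of_nat k :: 'a) = 0 \<longleftrightarrow> p dvd k"
  using of_nat_eq_0_iff_char_dvd[where 'a = 'a] char_p by simp

lemma of_nat_p [simp]: "(of_nat p :: 'a) = 0"
  by (simp add: of_nat_eq_0)

lemma of_nat_eq: "(of_nat i :: 'a) = of_nat j \<longleftrightarrow> i mod p = j mod p"
  using of_nat_eq_iff_cong_CHAR[where 'a = 'a] char_p by (simp add: cong_def)

lemma two_neq_0: "(2::'a) \<noteq> 0"
  using of_nat_eq_0[of 2] p_gt_2 by (auto dest: dvd_imp_le)

lemma inj_on_of_nat: "inj_on (of_nat :: nat \<Rightarrow> 'a) {..<p}"
  by (auto simp: inj_on_def of_nat_eq)

lemma Fp_eq: "Fp = of_nat ` {..<p}"
proof -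
  have "(of_nat k :: 'a) \<in> of_nat ` {..<p}" for k
    using p_gt_2 by (intro image_eqI[of _ _ "k mod p"]) (auto simp: of_nat_eq)
  then show ?thesis by (auto simp: Fp_def)
qed

lemma card_Fp: "card Fp = p"
  by (simp add: Fp_eq card_image inj_on_of_nat)

lemma of_nat_Fp [simp]: "of_nat k \<in> Fp" by (simp add: Fp_def)

lemma zero_Fp [simp]: "0 \<in> Fp" and one_Fp [simp]: "1 \<in> Fp"
  using of_nat_Fp[of 0] of_nat_Fp[of 1] by simp_all

lemma add_Fp: "x \<in> Fp \<Longrightarrow> y \<in> Fp \<Longrightarrow> x + y \<in> Fp"
  by (auto simp: Fp_def simp flip: of_nat_add)

lemma mult_Fp: "x \<in> Fp \<Longrightarrow> y \<in> Fp \<Longrightarrow> x * y \<in> Fp"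
  by (auto simp: Fp_def simp flip: of_nat_mult)

lemma uminus_Fp: assumes "x \<in> Fp" shows "- x \<in> Fp"
proof -
  have "(of_nat (p - 1) :: 'a) = - 1" using p_gt_2 by (simp add: of_nat_diff)
  then have "- 1 \<in> Fp" using of_nat_Fp by metis
  then show ?thesis using mult_Fp[of "-1" x] assms by simp
qed

lemma diff_Fp: "x \<in> Fp \<Longrightarrow> y \<in> Fp \<Longrightarrow> x - y \<in> Fp"
  using add_Fp[of x "- y"] uminus_Fp[of y] by simp

lemma power_Fp: "x \<in> Fp \<Longrightarrow> x ^ k \<in> Fp"
  by (induction k) (auto intro: mult_Fp)

section \<open>Powers of Frobenius and their fixed fields\<close>

lemma frob_add: "(x + y :: 'a) ^ (p ^ i) = x ^ (p ^ i) + y ^ (p ^ i)"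
  by (rule freshmans_dream') (use prime_p char_p in auto)

lemma frob_uminus: "(- x :: 'a) ^ (p ^ i) = - (x ^ (p ^ i))"
  using odd_p by simp

lemma frob_diff: "(x - y :: 'a) ^ (p ^ i) = x ^ (p ^ i) - y ^ (p ^ i)"
  using frob_add[of x "- y" i] frob_uminus by simp

lemma frob_sum: "(sum f A :: 'a) ^ (p ^ i) = (\<Sum>a\<in>A. f a ^ (p ^ i))"
  by (rule freshmans_dream_sum') (use prime_p char_p in auto)

lemma frob_frob: "((x::'a) ^ (p ^ i)) ^ (p ^ j) = x ^ (p ^ (i + j))"
  by (simp add: power_add power_mult)

lemma frob_eq_0: "(x::'a) ^ (p ^ i) = 0 \<longleftrightarrow> x = 0"
  using p_gt_2 by simp

lemma frob_inj: "(x::'a) ^ (p ^ i) = y ^ (p ^ i) \<Longrightarrow> x = y"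
  using frob_diff[of x y i] frob_eq_0[of "x - y" i] by simp

lemma funpow_frob: "((\<lambda>x::'a. x ^ p) ^^ i) x = x ^ (p ^ i)"
  by (induction i) (auto simp: mult.commute simp flip: power_mult)

lemma frob_Fp: assumes "x \<in> Fp" shows "x ^ (p ^ i) = x"
proof -
  have "(of_nat k :: 'a) ^ (p ^ i) = of_nat k" for k
    using p_gt_2 by (induction k) (auto simp: frob_add zero_power)
  then show ?thesis using assms by (auto simp: Fp_def)
qed

lemma K_frob_mult: "x \<in> K d \<Longrightarrow> x ^ (p ^ (d * i)) = x"
  using funpow_fixed_mult[of d "\<lambda>x. x ^ p" x i] by (simp add: funpow_frob K_def)

lemma K_gcd: "x \<in> K a \<Longrightarrow> x \<in> K b \<Longrightarrow> x \<in> K (gcd a b)"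
  using funpow_fixed_gcd[of a "\<lambda>x. x ^ p" x b] by (simp add: funpow_frob K_def)

lemma Fp_subset_K: "Fp \<subseteq> K d"
  using frob_Fp by (auto simp: K_def)

lemma K_1: "K 1 = Fp"
proof (rule sym, rule card_seteq)
  show "card (K 1) \<le> card Fp"
    using card_power_fixed_le[where ?'a = 'a, of p] p_gt_2 by (simp add: K_def card_Fp)
qed (simp_all add: Fp_subset_K)

lemma subspace_K: "subspace_Fp (K d)"
  unfolding subspace_Fp_def K_def
  using p_gt_2 by (auto simp: frob_add power_mult_distrib frob_Fp zero_power)

lemma K_mult: "x \<in> K d \<Longrightarrow> y \<in> K d \<Longrightarrow> x * y \<in> K d"
  by (simp add: K_def power_mult_distrib)

lemma K_add: "x \<in> K d \<Longrightarrow> y \<in> K d \<Longrightarrow> x + y \<in> K d"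
  by (simp add: K_def frob_add)

lemma K_diff: "x \<in> K d \<Longrightarrow> y \<in> K d \<Longrightarrow> x - y \<in> K d"
  by (simp add: K_def frob_diff)

lemma K_divide: "x \<in> K d \<Longrightarrow> y \<in> K d \<Longrightarrow> x / y \<in> K d"
  by (simp add: K_def power_divide)

lemma K_power: "x \<in> K d \<Longrightarrow> x ^ k \<in> K d"
  by (simp add: K_def power_mult[symmetric, of x] mult.commute[of k] power_mult[of x "p ^ d"])

text \<open>The bound from above counts roots of \<open>X^q - X\<close>. For the bound from below,
  the relative trace maps the whole field into \<open>K m\<close> with fibres of at most
  \<open>q ^ (k - 1)\<close> elements.\<close>

lemma card_K:
  assumes "CARD('a) = p ^ n" "m dvd n" "n > 0"
  shows "card (K m) = p ^ m"
proof -
  obtain k where n: "n = m * k" using assms by blast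
  have pos: "m > 0" "k > 0" using n assms(3) by auto
  define q where "q = p ^ m"
  have q: "q \<ge> 2" using self_le_power[of p m] p_gt_2 pos(1) by (simp add: q_def)
  define f :: "'a \<Rightarrow> 'a" where "f x = (\<Sum>i<k. x ^ (q ^ i))" for x
  have fK: "f x \<in> K m" for x
  proof -
    \<comment> \<open>Raising to the power \<open>q\<close> shifts the summands by one place, and
      the last one becomes \<open>x ^ (q ^ k) = x\<close>.\<close>
    have "f x ^ (p ^ m) = (\<Sum>i<k. x ^ (q ^ Suc i))"
      unfolding f_def frob_sum q_def by (simp add: mult.commute flip: power_mult power_add)
    also have "\<dots> = (\<Sum>i<Suc k. x ^ (q ^ i)) - x"
      by (subst sum.lessThan_Suc_shift) simp
    also have "x ^ (q ^ k) = x"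
      using finite_field_power_card[of x] assms(1) n by (simp add: q_def flip: power_mult)
    then have "(\<Sum>i<Suc k. x ^ (q ^ i)) - x = f x" by (simp add: f_def)
    finally show ?thesis by (simp add: K_def)
  qed
  have fib: "card {x. f x = y} \<le> q ^ (k - 1)" for y
    unfolding f_def using card_power_sum_fibre_le q pos by blast
  have "card {x::'a. x ^ q = x} \<le> q"
    using card_power_fixed_le q by blast
  then have le: "card (K m) \<le> q" by (simp add: K_def q_def)
  have "p ^ n = (\<Sum>y\<in>K m. card {x. f x = y})"
    using card_fibres[of UNIV "K m" f] fK assms(1) by auto
  also have "\<dots> \<le> card (K m) * q ^ (k - 1)"
    using sum_bounded_above[of "K m" "\<lambda>y. card {x. f x = y}" "q ^ (k - 1)"] fib by simp
  finally have "q * q ^ (k - 1) \<le> card (K m) * q ^ (k - 1)"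
    using pos by (simp add: n q_def power_mult flip: power_Suc)
  then have "q \<le> card (K m)" using q by simp
  with le show ?thesis by (simp add: q_def)
qed

end

section \<open>Additive characters\<close>

lemma eps_add: "eps p (a + b) = eps p a * eps p b"
  by (simp add: eps_def cis_mult ring_distribs add_divide_distrib)

lemma eps_mult_p: "p > 0 \<Longrightarrow> eps p (int p * k) = 1"
  unfolding eps_def by (subst cis_eq_1_iff) (auto intro!: exI[of _ k])

lemma eps_eq_1_iff: assumes "p > 0" shows "eps p k = 1 \<longleftrightarrow> int p dvd k"
proof
  assume "eps p k = 1"
  then obtain m where "2 * pi * of_int k / real p = of_int m * (2 * pi)"
    unfolding eps_def cis_eq_1_iff by blast
  then have "real_of_int k = real_of_int (m * int p)"
    using assms by (simp add: field_simps)
  then have "k = m * int p" by (simp only: of_int_eq_iff)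
  then show "int p dvd k" by simp
qed (use eps_mult_p assms in \<open>auto simp: dvd_def\<close>)

lemma eps_mod: assumes "p > 0" shows "eps p (int (k mod p)) = eps p (int k)"
proof -
  have "int k = int p * int (k div p) + int (k mod p)"
    by (simp flip: of_nat_mult of_nat_add)
  then show ?thesis using eps_mult_p[OF assms] by (simp only: eps_add mult_1)
qed

context odd_char
begin

section \<open>The canonical character of the prime field\<close>

lemma fp_val_of_nat: "fp_val p (of_nat k :: 'a) = k mod p"
  unfolding fp_val_def using p_gt_2 by (intro the_equality) (auto simp: of_nat_eq)

lemma ch_of_nat: "ch (of_nat k) = eps p (int k)"
  using p_gt_2 by (simp add: ch_def fp_val_of_nat eps_mod)

lemma of_nat_fp_val: "t \<in> Fp \<Longrightarrow> of_nat (fp_val p t) = t"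
  by (auto simp: Fp_def fp_val_of_nat of_nat_eq)

lemma fp_val_less: "t \<in> Fp \<Longrightarrow> fp_val p t < p"
  using p_gt_2 by (auto simp: Fp_def fp_val_of_nat)

lemma ch_add: assumes "s \<in> Fp" "t \<in> Fp" shows "ch (s + t) = ch s * ch t"
proof -
  obtain i j where "s = of_nat i" "t = of_nat j" using assms by (auto simp: Fp_def)
  then show ?thesis
    using ch_of_nat[of "i + j"] eps_add[of p "int i" "int j"] by (simp add: ch_of_nat)
qed

lemma ch_0 [simp]: "ch 0 = 1"
  using ch_of_nat[of 0] by (simp add: eps_def)

lemma cmod_ch [simp]: "cmod (ch t) = 1"
  by (simp add: ch_def eps_def)

lemma ch_neq_0 [simp]: "ch t \<noteq> 0"
  using cmod_ch[of t] by force

lemma ch_eq_1_iff: "t \<in> Fp \<Longrightarrow> ch t = 1 \<longleftrightarrow> t = 0"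
  using p_gt_2 by (auto simp: Fp_def ch_of_nat eps_eq_1_iff of_nat_eq_0)

lemma ch_uminus: assumes "t \<in> Fp" shows "ch (- t) = cnj (ch t)"
proof -
  have "ch t * ch (- t) = 1" using ch_add[of t "- t"] assms uminus_Fp by simp
  moreover have "ch t * cnj (ch t) = 1" by (simp add: complex_norm_square[symmetric])
  ultimately show ?thesis by (metis ch_neq_0 mult_left_cancel)
qed

lemma ch_diff: "s \<in> Fp \<Longrightarrow> t \<in> Fp \<Longrightarrow> ch (s - t) = ch s * cnj (ch t)"
  using ch_add[of s "- t"] uminus_Fp ch_uminus by simp

lemma subspace_add: "subspace_Fp V \<Longrightarrow> x \<in> V \<Longrightarrow> y \<in> V \<Longrightarrow> x + y \<in> V"
  and subspace_scale: "subspace_Fp V \<Longrightarrow> a \<in> Fp \<Longrightarrow> x \<in> V \<Longrightarrow> a * x \<in> V"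
  and subspace_0: "subspace_Fp V \<Longrightarrow> 0 \<in> V"
  by (auto simp: subspace_Fp_def)

lemma subspace_uminus: "subspace_Fp V \<Longrightarrow> x \<in> V \<Longrightarrow> - x \<in> V"
  using subspace_scale[of V "- 1" x] uminus_Fp[of 1] by simp

lemma subspace_diff: "subspace_Fp V \<Longrightarrow> x \<in> V \<Longrightarrow> y \<in> V \<Longrightarrow> x - y \<in> V"
  using subspace_add[of V x "- y"] subspace_uminus by simp

lemma subspace_Fp_Fp: "subspace_Fp Fp"
  by (auto simp: subspace_Fp_def intro: add_Fp mult_Fp)

lemma sum_translate:
  assumes "subspace_Fp V" "y \<in> V"
  shows "(\<Sum>x\<in>V. f (x + y)) = (\<Sum>x\<in>V. f x)"
  by (rule sum.reindex_bij_witness[where i = "\<lambda>x. x - y" and j = "\<lambda>x. x + y"])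
     (use assms subspace_add subspace_diff in auto)

text \<open>Translation by some \<open>y\<close> with \<open>l y \<noteq> 0\<close> multiplies the
  sum by \<open>ch (l y) \<noteq> 1\<close>, so the sum vanishes.\<close>

lemma sum_ch_linear:
  assumes "subspace_Fp V" "linear_Fp V l"
  shows "(\<Sum>x\<in>V. ch (l x)) = (if \<forall>x\<in>V. l x = 0 then of_nat (card V) else 0)"
proof (cases "\<forall>x\<in>V. l x = 0")
  case False
  then obtain y where y: "y \<in> V" "l y \<noteq> 0" by blast
  have "(\<Sum>x\<in>V. ch (l x)) = (\<Sum>x\<in>V. ch (l (x + y)))"
    using sum_translate[OF assms(1) y(1), of "\<lambda>x. ch (l x)"] by simp
  also have "\<dots> = (\<Sum>x\<in>V. ch (l x)) * ch (l y)"
    unfolding sum_distrib_right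
    using assms y by (intro sum.cong) (auto simp: linear_Fp_def ch_add)
  finally have "(\<Sum>x\<in>V. ch (l x)) * (ch (l y) - 1) = 0" by (simp add: algebra_simps)
  moreover have "ch (l y) \<noteq> 1" using y assms ch_eq_1_iff by (auto simp: linear_Fp_def)
  ultimately show ?thesis using False by auto
qed simp

lemma sum_ch_mult:
  assumes "t \<in> Fp"
  shows "(\<Sum>j\<in>Fp. ch (j * t)) = (if t = 0 then of_nat p else 0)"
proof -
  have "linear_Fp Fp (\<lambda>j. j * t)"
    using assms by (auto simp: linear_Fp_def ring_distribs intro: mult_Fp)
  moreover have "(\<forall>j\<in>Fp. j * t = 0) \<longleftrightarrow> t = 0"
    using bspec[of Fp "\<lambda>j. j * t = 0" 1] by auto
  ultimately show ?thesis
    using sum_ch_linear[OF subspace_Fp_Fp, of "\<lambda>j. j * t"] by (simp only: card_Fp)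
qed

text \<open>The nonsquare is wanted in the shape \<open>s\<^sup>2 + 1\<close> because
  \<open>gsum_sum_squares\<close> compares the sums of \<open>Q\<close> and of such a multiple of
  \<open>Q\<close>. The least natural number that is neither zero nor a square modulo
  \<open>p\<close> has this shape.\<close>

lemma ex_nonsquare:
  obtains a s where "a \<in> Fp" "s \<in> Fp" "a = s\<^sup>2 + 1" "a \<noteq> 0"
    "Fp - {0} = (\<lambda>x. x\<^sup>2) ` (Fp - {0}) \<union> (\<lambda>x. a * x\<^sup>2) ` (Fp - {0})"
    "(\<lambda>x. x\<^sup>2) ` (Fp - {0}) \<inter> (\<lambda>x. a * x\<^sup>2) ` (Fp - {0}) = {}"
proof -
  let ?U = "Fp - {0} :: 'a set"
  let ?S = "(\<lambda>x. x\<^sup>2) ` ?U"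
  have U: "card ?U = p - 1" by (simp add: card_Fp)
  have S: "?S \<subseteq> ?U" by (auto intro: power_Fp)
  have fibre: "card {x \<in> ?U. x\<^sup>2 = y} = 2" if "y \<in> ?S" for y
  proof -
    from that obtain s where s: "s \<in> ?U" "y = s\<^sup>2" by blast
    have "{x \<in> ?U. x\<^sup>2 = y} = {s, - s}"
      using s uminus_Fp by (auto simp: power2_eq_iff)
    moreover have "s \<noteq> - s"
    proof
      assume "s = - s"
      then have "2 * s = 0" by (metis add.right_inverse mult_2)
      then show False using s two_neq_0 by simp
    qed
    ultimately show ?thesis by simp
  qed
  have cS: "p - 1 = card ?S * 2"
    using card_fibres[of ?U ?S "\<lambda>x. x\<^sup>2"] U fibre by simp
  define P where "P k \<longleftrightarrow> (of_nat k :: 'a) \<notin> insert 0 ?S" for k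
  have "\<exists>k. P k"
  proof (rule ccontr)
    assume "\<nexists>k. P k"
    then have "Fp \<subseteq> insert 0 ?S" by (auto simp: P_def Fp_def)
    then have "?U \<subseteq> ?S" by blast
    then have "card ?U \<le> card ?S" by (intro card_mono) auto
    then show False using cS U p_gt_2 by linarith
  qed
  define k where "k = (LEAST k. P k)"
  have k: "P k" unfolding k_def using \<open>\<exists>k. P k\<close> by (rule LeastI_ex)
  then have "k > 0" by (cases k) (auto simp: P_def)
  have kFp: "of_nat k \<in> Fp" by simp
  \<comment> \<open>By minimality the predecessor is zero or a nonzero square; \<open>s\<close> may
    therefore be zero.\<close>
  from \<open>k > 0\<close> have "\<not> P (k - 1)" unfolding k_def by (intro not_less_Least) simp
  then obtain s where s: "s \<in> Fp" "of_nat (k - 1) = s\<^sup>2" by (auto simp: P_def)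
  define a where "a = (of_nat k :: 'a)"
  have a: "a \<in> Fp" "a = s\<^sup>2 + 1" "a \<noteq> 0" "a \<notin> ?S"
    using k s \<open>k > 0\<close> kFp unfolding a_def P_def by (auto simp: of_nat_diff diff_eq_eq)
  let ?N = "(\<lambda>x. a * x\<^sup>2) ` ?U"
  have disj: "?S \<inter> ?N = {}"
  proof (rule ccontr)
    assume "?S \<inter> ?N \<noteq> {}"
    then obtain x y where xy: "x \<in> ?U" "y \<in> ?U" "x\<^sup>2 = a * y\<^sup>2" by auto
    then have "a = (x / y)\<^sup>2" by (simp add: power_divide field_simps)
    moreover have "x / y \<in> ?U" using xy K_divide[of x 1 y, unfolded K_1] by simp
    ultimately show False using a by blast
  qed
  have N: "?N \<subseteq> ?U" using a by (auto intro: power_Fp mult_Fp)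
  \<comment> \<open>Squares and their multiples by \<open>a\<close> are disjoint classes of equal
    size. As the squares form half of the nonzero elements, the two classes exhaust them.\<close>
  have "?N = (\<lambda>x. a * x) ` ?S" by auto
  moreover have "inj_on (\<lambda>x. a * x) ?S" using a by (auto intro: inj_onI)
  ultimately have cN: "card ?N = card ?S" by (simp only: card_image)
  have "card (?S \<union> ?N) = card ?S + card ?N"
    by (rule card_Un_disjoint) (use disj in auto)
  then have "card (?S \<union> ?N) = card ?U" using cN cS U by simp
  moreover have "?S \<union> ?N \<subseteq> ?U" using S N by (rule Un_least)
  ultimately have "?S \<union> ?N = ?U" by (intro card_seteq) auto
  then show ?thesis using that[of a s] a s disj by simp
qed

end

section \<open>Exponential sums of quadratic forms\<close>

context odd_char
begin

text \<open>\<open>B\<close> is the polarisation of \<open>Q\<close>. Only linearity in its first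
  argument is demanded; symmetry on \<open>V\<close> follows from
  \<open>Q (x + y) = Q (y + x)\<close>.\<close>

definition quadratic :: "'a set \<Rightarrow> ('a \<Rightarrow> 'a) \<Rightarrow> ('a \<Rightarrow> 'a \<Rightarrow> 'a) \<Rightarrow> bool" where
  "quadratic V Q B \<longleftrightarrow> subspace_Fp V \<and> (\<forall>x\<in>V. Q x \<in> Fp) \<and>
     (\<forall>x\<in>V. \<forall>y\<in>V. Q (x + y) = Q x + Q y + B x y) \<and>
     (\<forall>a\<in>Fp. \<forall>x\<in>V. Q (a * x) = a\<^sup>2 * Q x) \<and>
     (\<forall>y\<in>V. linear_Fp V (\<lambda>x. B x y)) \<and>
     (\<forall>a\<in>Fp. \<forall>x\<in>V. \<forall>y\<in>V. B (a * x) y = a * B x y)"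

definition radical :: "'a set \<Rightarrow> ('a \<Rightarrow> 'a \<Rightarrow> 'a) \<Rightarrow> 'a set" where
  "radical V B = {x\<in>V. \<forall>y\<in>V. B y x = 0}"

definition W :: "'a set \<Rightarrow> ('a \<Rightarrow> 'a) \<Rightarrow> ('a \<Rightarrow> 'a) \<Rightarrow> complex" where
  "W V Q l = (\<Sum>x\<in>V. ch (Q x - l x))"

definition gsum :: "'a set \<Rightarrow> ('a \<Rightarrow> 'a) \<Rightarrow> 'a \<Rightarrow> complex" where
  "gsum V Q j = (\<Sum>x\<in>V. ch (j * Q x))"

definition level :: "'a set \<Rightarrow> ('a \<Rightarrow> 'a) \<Rightarrow> 'a \<Rightarrow> nat" where
  "level V Q i = card {x\<in>V. Q x = i}"

section \<open>Quadratic forms, their radicals and their Walsh sums\<close>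

lemma quadraticD:
  assumes "quadratic V Q B"
  shows quadratic_subspace: "subspace_Fp V"
    and quadratic_Fp: "x \<in> V \<Longrightarrow> Q x \<in> Fp"
    and quadratic_add: "x \<in> V \<Longrightarrow> y \<in> V \<Longrightarrow> Q (x + y) = Q x + Q y + B x y"
    and quadratic_scale: "a \<in> Fp \<Longrightarrow> x \<in> V \<Longrightarrow> Q (a * x) = a\<^sup>2 * Q x"
    and bilinear_Fp: "x \<in> V \<Longrightarrow> y \<in> V \<Longrightarrow> B x y \<in> Fp"
    and bilinear_scale: "a \<in> Fp \<Longrightarrow> x \<in> V \<Longrightarrow> y \<in> V \<Longrightarrow> B (a * x) y = a * B x y"
  using assms unfolding quadratic_def linear_Fp_def by blast+

lemma bilinear_commute:
  assumes "quadratic V Q B" "x \<in> V" "y \<in> V"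
  shows "B x y = B y x"
  using quadratic_add[OF assms(1-3)] quadratic_add[OF assms(1,3,2)] by (simp add: add.commute)

lemma quadratic_0: "quadratic V Q B \<Longrightarrow> Q 0 = 0"
  using quadratic_scale[of V Q B 0 0] subspace_0[of V] quadratic_subspace[of V Q B] by simp

lemma radicalD: "z \<in> radical V B \<Longrightarrow> z \<in> V" "z \<in> radical V B \<Longrightarrow> y \<in> V \<Longrightarrow> B y z = 0"
  by (auto simp: radical_def)

text \<open>Compute \<open>Q (z + z)\<close> once by scaling, as \<open>4 * Q z\<close>, and once by
  polarisation.\<close>

lemma bilinear_diag:
  assumes "quadratic V Q B" "z \<in> V"
  shows "B z z = 2 * Q z"
proof -
  have "(2::'a) \<in> Fp" using of_nat_Fp[of 2] by simp
  then have "2\<^sup>2 * Q z = Q (z + z)"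
    using quadratic_scale[OF assms(1) _ assms(2), of 2] by (simp only: mult_2)
  also have "\<dots> = Q z + Q z + B z z" using quadratic_add[OF assms(1,2,2)] .
  finally show ?thesis by (simp add: power2_eq_square)
qed

lemma quadratic_radical:
  assumes "quadratic V Q B" "z \<in> radical V B"
  shows "Q z = 0"
  using bilinear_diag[OF assms(1), of z] assms(2) two_neq_0 by (auto simp: radical_def)

lemma quadratic_scaled:
  assumes "quadratic V Q B" "j \<in> Fp"
  shows "quadratic V (\<lambda>x. j * Q x) (\<lambda>x y. j * B x y)"
  using assms unfolding quadratic_def linear_Fp_def
  by (auto simp: algebra_simps intro: mult_Fp)

lemma radical_scaled: "j \<noteq> 0 \<Longrightarrow> radical V (\<lambda>x y. j * B x y) = radical V B"
  by (simp add: radical_def)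

text \<open>Substituting \<open>x = z + y\<close> in the double sum cancels \<open>Q y\<close> and
  leaves an exponent linear in \<open>y\<close>. Two functionals are kept apart because
  \<open>W_complete_square\<close> pairs \<open>l\<close> with \<open>0\<close>.\<close>

lemma W_mult_cnj:
  assumes Q: "quadratic V Q B" and l: "linear_Fp V l" "linear_Fp V l'"
  shows "W V Q l * cnj (W V Q l') =
    (\<Sum>z\<in>V. ch (Q z - l z) * (\<Sum>y\<in>V. ch (B y z - (l y - l' y))))"
proof -
  have eq: "ch (Q (z + y) - l (z + y)) * cnj (ch (Q y - l' y)) =
      ch (Q z - l z) * ch (B y z - (l y - l' y))" if "z \<in> V" "y \<in> V" for y z
  proof -
    have lF: "l z \<in> Fp" "l y \<in> Fp" "l' y \<in> Fp" "l (z + y) = l z + l y" "l (z + y) \<in> Fp"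
      using l that subspace_add[OF quadratic_subspace[OF Q]] by (auto simp: linear_Fp_def intro: add_Fp)
    have zy: "z + y \<in> V" using that subspace_add[OF quadratic_subspace[OF Q]] by blast
    have Fp: "Q z - l z \<in> Fp" "Q y - l' y \<in> Fp" "B y z - (l y - l' y) \<in> Fp"
        "Q (z + y) - l (z + y) \<in> Fp"
      by (intro diff_Fp quadratic_Fp[OF Q] bilinear_Fp[OF Q] that zy lF)+
    have "Q (z + y) - l (z + y) - (Q y - l' y) = (Q z - l z) + (B y z - (l y - l' y))"
      using quadratic_add[OF Q that] bilinear_commute[OF Q that] lF by simp
    then have "ch (Q (z + y) - l (z + y) - (Q y - l' y)) =
        ch ((Q z - l z) + (B y z - (l y - l' y)))" by (rule arg_cong)
    moreover have "ch (Q (z + y) - l (z + y) - (Q y - l' y)) =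
        ch (Q (z + y) - l (z + y)) * cnj (ch (Q y - l' y))"
      by (rule ch_diff) (rule Fp)+
    moreover have "ch ((Q z - l z) + (B y z - (l y - l' y))) =
        ch (Q z - l z) * ch (B y z - (l y - l' y))"
      by (rule ch_add) (rule Fp)+
    ultimately show ?thesis by (simp only:)
  qed
  have "W V Q l * cnj (W V Q l') =
      (\<Sum>y\<in>V. (\<Sum>x\<in>V. ch (Q x - l x)) * cnj (ch (Q y - l' y)))"
    by (simp add: W_def sum_distrib_left cnj_sum)
  also have "\<dots> = (\<Sum>y\<in>V. (\<Sum>z\<in>V. ch (Q (z + y) - l (z + y))) * cnj (ch (Q y - l' y)))"
    using sum_translate[OF quadratic_subspace[OF Q], of _ "\<lambda>x. ch (Q x - l x)"]
    by (intro sum.cong) auto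
  also have "\<dots> = (\<Sum>y\<in>V. \<Sum>z\<in>V. ch (Q z - l z) * ch (B y z - (l y - l' y)))"
    by (simp add: sum_distrib_right eq cong: sum.cong)
  also have "\<dots> = (\<Sum>z\<in>V. ch (Q z - l z) * (\<Sum>y\<in>V. ch (B y z - (l y - l' y))))"
    by (subst sum.swap) (simp add: sum_distrib_left)
  finally show ?thesis .
qed

text \<open>By orthogonality only \<open>z\<close> in the radical survives, and there both
  \<open>Q\<close> and \<open>l\<close> vanish.\<close>

lemma W_norm:
  assumes Q: "quadratic V Q B" and l: "linear_Fp V l" "\<And>z. z \<in> radical V B \<Longrightarrow> l z = 0"
  shows "W V Q l * cnj (W V Q l) = of_nat (card V * card (radical V B))"
proof -
  have "(\<Sum>y\<in>V. ch (B y z)) = (if z \<in> radical V B then of_nat (card V) else 0)"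
    if "z \<in> V" for z
    using sum_ch_linear[OF quadratic_subspace[OF Q], of "\<lambda>y. B y z"] Q that
    by (auto simp: quadratic_def radical_def)
  then have "W V Q l * cnj (W V Q l) =
      (\<Sum>z\<in>V. if z \<in> radical V B then ch (Q z - l z) * of_nat (card V) else 0)"
    by (subst W_mult_cnj[OF Q l(1) l(1)]) (auto intro!: sum.cong)
  also have "\<dots> = (\<Sum>z\<in>radical V B. ch (Q z - l z) * of_nat (card V))"
    by (rule sum.mono_neutral_cong_right) (auto simp: radicalD)
  also have "\<dots> = (\<Sum>z\<in>radical V B. of_nat (card V))"
    using quadratic_radical[OF Q] l(2) by (intro sum.cong) auto
  finally show ?thesis by simp
qed

text \<open>Translation by \<open>z\<close> leaves \<open>Q\<close> unchanged and multiplies the sum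
  by \<open>ch (- l z) \<noteq> 1\<close>.\<close>

lemma W_eq_0:
  assumes Q: "quadratic V Q B" and l: "linear_Fp V l" and z: "z \<in> radical V B" "l z \<noteq> 0"
  shows "W V Q l = 0"
proof -
  have zV: "z \<in> V" using z radicalD by blast
  have "W V Q l = (\<Sum>x\<in>V. ch (Q (x + z) - l (x + z)))"
    unfolding W_def using sum_translate[OF quadratic_subspace[OF Q] zV, of "\<lambda>x. ch (Q x - l x)"] by simp
  also have "\<dots> = (\<Sum>x\<in>V. ch (Q x - l x) * ch (- l z))"
  proof (rule sum.cong)
    fix x assume x: "x \<in> V"
    have "Q (x + z) - l (x + z) = (Q x - l x) + (- l z)"
      using quadratic_add[OF Q x zV] quadratic_radical[OF Q z(1)] radicalD(2)[OF z(1) x] l x zV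
      by (simp add: linear_Fp_def)
    then show "ch (Q (x + z) - l (x + z)) = ch (Q x - l x) * ch (- l z)"
      using x zV l quadratic_Fp[OF Q]
      by (subst ch_add[symmetric]) (auto simp: linear_Fp_def diff_diff_eq intro: diff_Fp uminus_Fp)
  qed simp
  finally have "W V Q l = W V Q l * ch (- l z)"
    unfolding W_def sum_distrib_right .
  then have "W V Q l * (ch (- l z) - 1) = 0"
    by (simp add: right_diff_distrib)
  moreover have "ch (- l z) \<noteq> 1"
    using ch_eq_1_iff[of "- l z"] z zV l uminus_Fp by (auto simp: linear_Fp_def)
  ultimately show ?thesis by simp
qed

text \<open>A functional vanishing on the radical has the form \<open>y \<mapsto> B y z\<close>.
  Translation by \<open>z\<close> then removes the linear term, and \<open>B z z = 2 * Q z\<close>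
  leaves the constant \<open>- Q z\<close>.\<close>

lemma W_complete_square:
  assumes Q: "quadratic V Q B" and l: "linear_Fp V l" "\<And>z. z \<in> radical V B \<Longrightarrow> l z = 0"
  obtains z where "z \<in> V" "W V Q l = ch (- Q z) * W V Q (\<lambda>_. 0)"
proof -
  have sub: "subspace_Fp V" by (rule quadratic_subspace[OF Q])
  have lin0: "linear_Fp V (\<lambda>_. 0)" by (simp add: linear_Fp_def)
  have "V \<noteq> {}" using subspace_0[OF sub] by blast
  have "0 \<in> radical V B"
  proof -
    have "B y 0 = 0" if "y \<in> V" for y
      using quadratic_add[OF Q that subspace_0[OF sub]] quadratic_0[OF Q] by simp
    then show ?thesis using subspace_0[OF sub] by (simp add: radical_def)
  qed
  then have "card V * card (radical V B) \<noteq> 0" using \<open>V \<noteq> {}\<close> by auto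
  then have "of_nat (card V * card (radical V B)) \<noteq> (0 :: complex)" by (simp only: of_nat_eq_0_iff) simp
  then have ne: "W V Q l \<noteq> 0" "W V Q (\<lambda>_. 0) \<noteq> 0"
    using W_norm[OF Q l] W_norm[OF Q lin0] by auto
  txt \<open>If no \<open>z\<close> represents \<open>l\<close>, then \<open>W_mult_cnj\<close> makes the product of two nonzero sums vanish.\<close>
  have "\<exists>z\<in>V. \<forall>y\<in>V. B y z = l y"
  proof (rule ccontr)
    assume no: "\<not> (\<exists>z\<in>V. \<forall>y\<in>V. B y z = l y)"
    have "(\<Sum>y\<in>V. ch (B y z - l y)) = 0" if "z \<in> V" for z
    proof -
      have lin: "linear_Fp V (\<lambda>y. B y z - l y)"
        using l that Q by (auto simp: linear_Fp_def quadratic_def intro: diff_Fp)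
      have "\<not> (\<forall>y\<in>V. B y z - l y = 0)" using no that by auto
      then show ?thesis using sum_ch_linear[OF sub lin] by (simp only: if_not_P if_False)
    qed
    then have "W V Q l * cnj (W V Q (\<lambda>_. 0)) = 0"
      by (subst W_mult_cnj[OF Q l(1) lin0]) (auto intro!: sum.neutral)
    then show False using ne by simp
  qed
  then obtain z where z: "z \<in> V" "\<And>y. y \<in> V \<Longrightarrow> B y z = l y" by blast
  have "W V Q l = (\<Sum>x\<in>V. ch (Q (x + z) - l (x + z)))"
    unfolding W_def using sum_translate[OF sub z(1), of "\<lambda>x. ch (Q x - l x)"] by simp
  also have "\<dots> = (\<Sum>x\<in>V. ch (- Q z) * ch (Q x))"
  proof (rule sum.cong)
    fix x assume x: "x \<in> V"
    have "B z z = 2 * Q z" by (rule bilinear_diag[OF Q z(1)])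
    then have "Q (x + z) - l (x + z) = - Q z + Q x"
      using quadratic_add[OF Q x z(1)] z(2)[OF x] z(2)[OF z(1)] l x z(1)
      by (simp add: linear_Fp_def)
    then show "ch (Q (x + z) - l (x + z)) = ch (- Q z) * ch (Q x)"
      using x z(1) quadratic_Fp[OF Q]
      by (subst ch_add[symmetric]) (auto intro: uminus_Fp)
  qed simp
  finally have "W V Q l = ch (- Q z) * W V Q (\<lambda>_. 0)"
    by (simp add: W_def sum_distrib_left)
  then show ?thesis using that z by blast
qed

section \<open>Sums of scalar multiples of a form and its level sets\<close>

lemma gsum_norm:
  assumes "quadratic V Q B" "j \<in> Fp" "j \<noteq> 0"
  shows "gsum V Q j * cnj (gsum V Q j) = of_nat (card V * card (radical V B))"
proof -
  have "linear_Fp V (\<lambda>_. 0)" by (simp add: linear_Fp_def)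
  from W_norm[OF quadratic_scaled[OF assms(1,2)] this] assms(3)
  show ?thesis by (simp add: W_def gsum_def radical_scaled)
qed

lemma gsum_0: "gsum V Q 0 = of_nat (card V)"
  by (simp add: gsum_def)

lemma gsum_level:
  assumes "quadratic V Q B"
  shows "gsum V Q j = (\<Sum>i\<in>Fp. of_nat (level V Q i) * ch (j * i))"
proof -
  have "gsum V Q j = (\<Sum>i\<in>Fp. \<Sum>x\<in>{x\<in>V. Q x = i}. ch (j * Q x))"
    unfolding gsum_def using quadratic_Fp[OF assms] by (intro sum.group[symmetric]) auto
  also have "\<dots> = (\<Sum>i\<in>Fp. of_nat (level V Q i) * ch (j * i))"
    unfolding level_def by (intro sum.cong) auto
  finally show ?thesis .
qed

lemma sum_level:
  assumes "quadratic V Q B"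
  shows "(\<Sum>i\<in>Fp. level V Q i) = card V"
  unfolding level_def using quadratic_Fp[OF assms] by (intro card_fibres[symmetric]) auto

text \<open>Fourier inversion on \<open>Fp\<close>: the sums \<open>gsum\<close> are the transform
  of the level sizes.\<close>

lemma level_fourier:
  assumes Q: "quadratic V Q B" and i: "i \<in> Fp"
  shows "of_nat (p * level V Q i) = (\<Sum>j\<in>Fp. gsum V Q j * cnj (ch (j * i)))"
proof -
  have "(\<Sum>j\<in>Fp. gsum V Q j * cnj (ch (j * i))) = (\<Sum>j\<in>Fp. \<Sum>x\<in>V. ch (j * (Q x - i)))"
    unfolding gsum_def sum_distrib_right
    using quadratic_Fp[OF Q] i
    by (intro sum.cong refl) (auto simp: right_diff_distrib ch_diff mult_Fp)
  also have "\<dots> = (\<Sum>x\<in>V. \<Sum>j\<in>Fp. ch (j * (Q x - i)))" by (rule sum.swap)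
  also have "\<dots> = (\<Sum>x\<in>V. if Q x = i then of_nat p else 0)"
    using quadratic_Fp[OF Q] i by (intro sum.cong refl) (simp add: sum_ch_mult diff_Fp)
  also have "\<dots> = of_nat (p * level V Q i)"
    by (simp add: level_def sum.If_cases Collect_conj_eq)
  finally show ?thesis by simp
qed

lemma level_parseval:
  assumes Q: "quadratic V Q B"
  shows "of_nat (p * (\<Sum>i\<in>Fp. (level V Q i)\<^sup>2)) = (\<Sum>j\<in>Fp. gsum V Q j * cnj (gsum V Q j))"
proof -
  have "(\<Sum>j\<in>Fp. gsum V Q j * cnj (gsum V Q j)) =
      (\<Sum>j\<in>Fp. \<Sum>i\<in>Fp. of_nat (level V Q i) * (gsum V Q j * cnj (ch (j * i))))"
    by (subst (2) gsum_level[OF Q]) (simp add: cnj_sum sum_distrib_left mult_ac)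
  also have "\<dots> = (\<Sum>i\<in>Fp. of_nat (level V Q i) * (\<Sum>j\<in>Fp. gsum V Q j * cnj (ch (j * i))))"
    by (subst sum.swap) (simp add: sum_distrib_left)
  also have "\<dots> = (\<Sum>i\<in>Fp. of_nat (level V Q i) * of_nat (p * level V Q i))"
    using level_fourier[OF Q] by (intro sum.cong) auto
  also have "\<dots> = of_nat (p * (\<Sum>i\<in>Fp. (level V Q i)\<^sup>2))"
    by (simp add: sum_distrib_left power2_eq_square mult_ac)
  finally show ?thesis by simp
qed

lemma scale_bij:
  assumes "quadratic V Q B" "s \<in> Fp" "s \<noteq> 0"
  shows "bij_betw (\<lambda>x. s * x) V V"
proof (rule bij_betw_byWitness[where f' = "\<lambda>x. inverse s * x"])
  have "inverse s \<in> Fp" using K_divide[of 1 1 s, unfolded K_1] assms by (simp add: inverse_eq_divide)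
  then show "(\<lambda>x. inverse s * x) ` V \<subseteq> V" "(\<lambda>x. s * x) ` V \<subseteq> V"
    using subspace_scale[OF quadratic_subspace[OF assms(1)]] assms(2) by auto
qed (use assms in auto)

lemma gsum_mult_square:
  assumes "quadratic V Q B" "s \<in> Fp" "s \<noteq> 0"
  shows "gsum V Q (j * s\<^sup>2) = gsum V Q j"
proof -
  have "gsum V Q j = (\<Sum>x\<in>V. ch (j * Q (s * x)))"
    unfolding gsum_def by (rule sum.reindex_bij_betw[OF scale_bij[OF assms], symmetric])
  also have "\<dots> = gsum V Q (j * s\<^sup>2)"
    unfolding gsum_def using quadratic_scale[OF assms(1,2)] by (simp add: mult.assoc)
  finally show ?thesis by simp
qed

lemma level_mult_square:
  assumes "quadratic V Q B" "s \<in> Fp" "s \<noteq> 0"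
  shows "level V Q (j * s\<^sup>2) = level V Q j"
proof -
  have "bij_betw (\<lambda>x. s * x) {x\<in>V. Q x = j} {x\<in>V. Q x = j * s\<^sup>2}"
  proof (rule bij_betw_subset[OF scale_bij[OF assms]])
    have im: "(\<lambda>x. s * x) ` V = V" using scale_bij[OF assms] by (rule bij_betw_imp_surj_on)
    have "s * x \<in> V \<and> (Q (s * x) = j * s\<^sup>2 \<longleftrightarrow> Q x = j)" if "x \<in> V" for x
      using quadratic_scale[OF assms(1,2) that] that im assms(3) by auto
    moreover have "x \<in> (\<lambda>x. s * x) ` V" if "x \<in> V" for x using im that by simp
    ultimately show "(\<lambda>x. s * x) ` {x\<in>V. Q x = j} = {x\<in>V. Q x = j * s\<^sup>2}"
      by (fastforce simp: image_iff)
  qed auto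
  then show ?thesis unfolding level_def by (rule bij_betw_same_card[symmetric])
qed

text \<open>The substitution \<open>(x, y) \<mapsto> (s x + y, x - s y)\<close> multiplies \<open>Q x + Q y\<close> by \<open>s\<^sup>2 + 1\<close>.\<close>

lemma gsum_sum_squares:
  assumes Q: "quadratic V Q B" and s: "s \<in> Fp" "s\<^sup>2 + 1 \<noteq> 0"
  shows "(gsum V Q (s\<^sup>2 + 1))\<^sup>2 = (gsum V Q 1)\<^sup>2"
proof -
  note sub = quadratic_subspace[OF Q]
  let ?h = "\<lambda>(x, y). (s * x + y, x - s * y)"
  have V: "s * x \<in> V" if "x \<in> V" for x using subspace_scale[OF sub s(1) that] .
  \<comment> \<open>The substitution has determinant \<open>- (s\<^sup>2 + 1)\<close>, which is
    nonzero.\<close>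
  have "inj_on ?h (V \<times> V)"
  proof (rule inj_onI, clarify)
    fix x y x' y' assume eq: "s * x + y = s * x' + y'" "x - s * y = x' - s * y'"
    have e1: "s * (x - x') = y' - y" using eq(1) by (simp add: algebra_simps)
    have e2: "x - x' = s * (y - y')" using eq(2) by (simp add: algebra_simps)
    have "(s\<^sup>2 + 1) * (y - y') = 0"
      using e1 unfolding e2 by (simp add: algebra_simps power2_eq_square)
    then have "y = y'" using s by simp
    then show "x = x' \<and> y = y'" using e2 by simp
  qed
  moreover have "?h ` (V \<times> V) \<subseteq> V \<times> V"
    using V subspace_add[OF sub] subspace_diff[OF sub] by auto
  ultimately have bij: "bij_betw ?h (V \<times> V) (V \<times> V)"
    by (simp add: bij_betw_def endo_inj_surj)
  have sq: "(gsum V Q j)\<^sup>2 = (\<Sum>(x, y)\<in>V\<times>V. ch (j * (Q x + Q y)))" if "j \<in> Fp" for j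
    unfolding gsum_def power2_eq_square[of "\<Sum>x\<in>V. ch (j * Q x)"] sum_product sum.cartesian_product
    using quadratic_Fp[OF Q] that
    by (intro sum.cong) (auto simp: ring_distribs ch_add mult_Fp)
  have Qh: "Q (s * x + y) + Q (x - s * y) = (s\<^sup>2 + 1) * (Q x + Q y)" if xy: "x \<in> V" "y \<in> V" for x y
  proof -
    have "Q (s * x + y) = s\<^sup>2 * Q x + Q y + s * B x y"
      using quadratic_add[OF Q V[OF xy(1)] xy(2)] quadratic_scale[OF Q s(1)] bilinear_scale[OF Q s(1)] xy
      by simp
    moreover have "Q (x - s * y) = Q x + s\<^sup>2 * Q y - s * B x y"
      using quadratic_add[OF Q xy(1) subspace_scale[OF sub uminus_Fp[OF s(1)] xy(2)]]
        quadratic_scale[OF Q uminus_Fp[OF s(1)] xy(2)]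
        bilinear_commute[OF Q xy(1) subspace_scale[OF sub uminus_Fp[OF s(1)] xy(2)]]
        bilinear_scale[OF Q uminus_Fp[OF s(1)] xy(2,1)] bilinear_commute[OF Q xy]
      by simp
    ultimately show ?thesis by (simp add: algebra_simps)
  qed
  have "(gsum V Q 1)\<^sup>2 = (\<Sum>(x, y)\<in>V\<times>V. ch (Q x + Q y))" using sq[of 1] by simp
  also have "\<dots> = (\<Sum>z\<in>V\<times>V. case ?h z of (x, y) \<Rightarrow> ch (Q x + Q y))"
    by (rule sum.reindex_bij_betw[OF bij, symmetric])
  also have "\<dots> = (\<Sum>(x, y)\<in>V\<times>V. ch ((s\<^sup>2 + 1) * (Q x + Q y)))"
    by (intro sum.cong) (auto simp: Qh)
  also have "\<dots> = (gsum V Q (s\<^sup>2 + 1))\<^sup>2"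
    using sq[of "s\<^sup>2 + 1"] s by (simp add: add_Fp power_Fp)
  finally show ?thesis by simp
qed

end

section \<open>Forms of even rank\<close>

text \<open>The multiplicity of \<open>p\<close> in a square is even.\<close>

lemma odd_prime_power_not_square:
  fixes d :: int
  assumes "prime p" "odd n"
  shows "d\<^sup>2 \<noteq> int p ^ n"
proof
  assume eq: "d\<^sup>2 = int p ^ n"
  define m where "m = nat \<bar>d\<bar>"
  have "int (m\<^sup>2) = int (p ^ n)" using eq by (simp add: m_def)
  then have m: "m\<^sup>2 = p ^ n" by (simp only: of_nat_eq_iff)
  have p: "prime_elem p" "p \<noteq> 0" "\<not> is_unit p"
    using assms(1) by (auto simp: prime_elem_nat_iff not_prime_unit)
  have "m \<noteq> 0" using m p(2) by (metis power_not_zero zero_power2)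
  then have "n = 2 * multiplicity p m"
    using prime_elem_multiplicity_power_distrib[OF p(1), of m 2] multiplicity_same_power[OF p(2,3), of n]
    unfolding m by simp
  then show False using assms(2) by simp
qed

context odd_char
begin

text \<open>\<open>gsum\<close> is constant on nonzero squares and on nonsquares, with values equal
  up to sign. Once they are shown to agree, Fourier inversion at \<open>0\<close> and
  \<open>1\<close> expresses the common value by level sizes, so it is an integer, and
  \<open>gsum_norm\<close> gives its square.\<close>

theorem gsum_eq_level_diff:
  assumes Q: "quadratic V Q B" and V: "card V = p ^ n" "odd n" and rad: "card (radical V B) = p"
  defines "S \<equiv> int (level V Q 0) - int (level V Q 1)"
  shows "gsum V Q 1 = of_int S" and "S\<^sup>2 = int p ^ (n + 1)"
proof -
  define g where "g = gsum V Q 1"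
  have gg: "gsum V Q j * cnj (gsum V Q j) = of_nat (p ^ (n + 1))" if "j \<in> Fp - {0}" for j
    using gsum_norm[OF Q, of j] that V rad by simp
  obtain a s where as: "a \<in> Fp" "s \<in> Fp" "a = s\<^sup>2 + 1" "a \<noteq> 0"
    and un: "Fp - {0} = (\<lambda>x. x\<^sup>2) ` (Fp - {0}) \<union> (\<lambda>x. a * x\<^sup>2) ` (Fp - {0})"
    and disj: "(\<lambda>x. x\<^sup>2) ` (Fp - {0}) \<inter> (\<lambda>x. a * x\<^sup>2) ` (Fp - {0}) = {}"
    by (rule ex_nonsquare)
  define X where "X = (\<lambda>x::'a. x\<^sup>2) ` (Fp - {0})"
  define Y where "Y = (\<lambda>x::'a. a * x\<^sup>2) ` (Fp - {0})"
  have XY: "Fp - {0} = X \<union> Y" "X \<inter> Y = {}" using un disj by (simp_all add: X_def Y_def)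
  have gX: "gsum V Q j = g" if "j \<in> X" for j
    using that gsum_mult_square[OF Q, of _ 1] by (auto simp: X_def g_def)
  have gY: "gsum V Q j = gsum V Q a" if "j \<in> Y" for j
    using that gsum_mult_square[OF Q, of _ a] by (auto simp: Y_def)
  have lX: "level V Q j = level V Q 1" if "j \<in> X" for j
    using that level_mult_square[OF Q, of _ 1] by (auto simp: X_def)
  have lY: "level V Q j = level V Q a" if "j \<in> Y" for j
    using that level_mult_square[OF Q, of _ a] by (auto simp: Y_def)
  have Y: "Y = (\<lambda>x. a * x) ` X" by (auto simp: X_def Y_def)
  have cY: "card Y = card X"
    unfolding Y using as(4) by (intro card_image) (auto intro: inj_onI)
  have "card (X \<union> Y) = card X + card Y" by (rule card_Un_disjoint) (use XY in auto)
  moreover have "card (Fp - {0}) = p - 1" by (simp add: card_Fp)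
  ultimately have cX: "p = 2 * card X + 1" using XY(1) cY p_gt_2 by simp
  have split: "(\<Sum>j\<in>Fp. f j) = f 0 + ((\<Sum>j\<in>X. f j) + (\<Sum>j\<in>Y. f j))"
    for f :: "'a \<Rightarrow> 'b::comm_monoid_add"
    by (subst sum.union_disjoint[symmetric])
       (use XY sum.remove[of Fp 0 f] in auto)
  have "(gsum V Q a)\<^sup>2 = g\<^sup>2"
    using gsum_sum_squares[OF Q as(2)] as by (simp add: g_def)
  then have "gsum V Q a = g \<or> gsum V Q a = - g" by (simp add: power2_eq_iff)
  txt \<open>With the other sign, Parseval's identity makes the deviation of the level sizes from
    \<open>p^(n-1)\<close> a square root of \<open>p^n\<close>, which is impossible for odd \<open>n\<close>.\<close>
  moreover have "gsum V Q a \<noteq> - g"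
  proof
    assume neg: "gsum V Q a = - g"
    define P where "P = int p ^ (n - 1)"
    have pn: "int p ^ n = int p * P" using V(2) by (cases n) (auto simp: P_def)
    define h where "h = int (card X)"
    define u where "u = int (level V Q 1)"
    define v where "v = int (level V Q a)"
    have hp: "int p = 2 * h + 1" using cX by (simp add: h_def)
    have p0: "int p \<noteq> 0" "h \<noteq> 0" using p_gt_2 hp by auto
    \<comment> \<open>Under the assumed sign the squares and the nonsquares cancel in the inversion
      formula at \<open>0\<close>.\<close>
    have "complex_of_nat (p * level V Q 0) = of_nat (p ^ n)"
      using level_fourier[OF Q zero_Fp] unfolding split
      by (simp add: gX gY neg cY V gsum_0)
    then have "p * level V Q 0 = p ^ n" by (simp only: of_nat_eq_iff)
    from arg_cong[OF this, of int] have "int p * int (level V Q 0) = int p * P" by (simp add: pn)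
    then have l0: "int (level V Q 0) = P" using p0 by simp
    \<comment> \<open>Counting all of \<open>V\<close> places the two other level sizes
      symmetrically about \<open>P\<close>.\<close>
    have "level V Q 0 + (card X * level V Q 1 + card X * level V Q a) = p ^ n"
      using sum_level[OF Q] unfolding split by (simp add: lX lY cY V)
    from arg_cong[OF this, of int] have "P + (h * u + h * v) = int p * P"
      by (simp add: h_def u_def v_def l0 pn)
    then have "h * (u + v - 2 * P) = 0"
      unfolding hp by (simp add: algebra_simps)
    then have v: "v = 2 * P - u" using p0 by simp
    \<comment> \<open>In Parseval's identity the coefficient at zero contributes
      \<open>p ^ n * p ^ n\<close>, and each of the \<open>2 * card X\<close> others contributes
      \<open>p ^ (n + 1)\<close>.\<close>
    have "complex_of_nat (p * ((level V Q 0)\<^sup>2 + (card X * (level V Q 1)\<^sup>2 + card X * (level V Q a)\<^sup>2))) =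
        of_nat (p ^ n * p ^ n + 2 * card X * p ^ (n + 1))"
    proof -
      have "(\<Sum>j\<in>X. gsum V Q j * cnj (gsum V Q j)) = of_nat (card X * p ^ (n + 1))"
        using gg XY by simp
      moreover have "(\<Sum>j\<in>Y. gsum V Q j * cnj (gsum V Q j)) = of_nat (card X * p ^ (n + 1))"
        using gg XY cY by simp
      ultimately show ?thesis
        using level_parseval[OF Q] unfolding split by (simp add: lX lY cY V gsum_0)
    qed
    then have "p * ((level V Q 0)\<^sup>2 + (card X * (level V Q 1)\<^sup>2 + card X * (level V Q a)\<^sup>2)) =
        p ^ n * p ^ n + 2 * card X * p ^ (n + 1)" by (simp only: of_nat_eq_iff)
    from arg_cong[OF this, of int]
    have "int p * (P\<^sup>2 + (h * u\<^sup>2 + h * v\<^sup>2)) = int p ^ n * int p ^ n + 2 * h * int p ^ (n + 1)"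
      by (simp only: of_nat_mult of_nat_add of_nat_power of_nat_numeral h_def u_def v_def l0)
    also have "\<dots> = int p * (int p * P\<^sup>2 + 2 * h * int p ^ n)"
      by (simp add: pn power2_eq_square algebra_simps)
    finally have "P\<^sup>2 + (h * u\<^sup>2 + h * v\<^sup>2) = int p * P\<^sup>2 + 2 * h * int p ^ n"
      using p0(1) by (simp only: mult_cancel_left) simp
    then have "P\<^sup>2 + (h * u\<^sup>2 + h * v\<^sup>2) = (2 * h + 1) * P\<^sup>2 + 2 * h * int p ^ n"
      by (simp only: hp[symmetric])
    then have "(2 * h) * ((u - P)\<^sup>2 - int p ^ n) = 0"
      unfolding v by (simp add: power2_eq_square algebra_simps)
    then have "(u - P)\<^sup>2 = int p ^ n" using p0 by simp
    then show False using odd_prime_power_not_square prime_p V(2) by blast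
  qed
  ultimately have ga: "gsum V Q a = g" by blast
  have gj: "gsum V Q j = g" if "j \<in> Fp - {0}" for j
    using that gX gY ga unfolding XY(1) by auto
  \<comment> \<open>All nonzero coefficients equal \<open>g\<close>, so inversion reduces to a full
    character sum minus its term at zero. That sum is \<open>p\<close> for \<open>i = 0\<close> and
    \<open>0\<close> for \<open>i = 1\<close>.\<close>
  have F: "of_nat (p * level V Q i) = of_nat (p ^ n) + g * ((\<Sum>j\<in>Fp. cnj (ch (j * i))) - 1)"
    if "i \<in> Fp" for i
  proof -
    have "of_nat (p * level V Q i) = gsum V Q 0 + (\<Sum>j\<in>Fp-{0}. gsum V Q j * cnj (ch (j * i)))"
      by (subst level_fourier[OF Q that], subst sum.remove[of _ 0]) auto
    also have "(\<Sum>j\<in>Fp-{0}. gsum V Q j * cnj (ch (j * i))) = g * (\<Sum>j\<in>Fp-{0}. cnj (ch (j * i)))"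
      using gj by (simp add: sum_distrib_left)
    also have "(\<Sum>j\<in>Fp-{0}. cnj (ch (j * i))) = (\<Sum>j\<in>Fp. cnj (ch (j * i))) - 1"
      by (subst sum.remove[of Fp 0]) auto
    finally show ?thesis by (simp add: gsum_0 V)
  qed
  have e0: "of_nat (p * level V Q 0) = of_nat (p ^ n) + g * (of_nat p - 1)"
    using F[OF zero_Fp] by (simp add: card_Fp)
  have e1: "of_nat (p * level V Q 1) = of_nat (p ^ n) - g"
    using F[OF one_Fp] sum_ch_mult[OF one_Fp] by (simp flip: cnj_sum)
  have "of_nat (p * level V Q 0) - of_nat (p * level V Q 1) = of_nat p * g"
    unfolding e0 e1 by (simp add: algebra_simps)
  then have "of_nat p * (of_int S :: complex) = of_nat p * g"
    by (simp add: S_def right_diff_distrib)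
  then have gS: "g = of_int S" using p_gt_2 by simp
  then show "gsum V Q 1 = of_int S" by (simp add: g_def)
  have "of_int (S * S) = (of_int (int p ^ (n + 1)) :: complex)"
    using gg[of 1] gS by (simp add: g_def)
  then show "S\<^sup>2 = int p ^ (n + 1)" by (simp only: of_int_eq_iff power2_eq_square)
qed

end

section \<open>Trace forms\<close>

context odd_char
begin

section \<open>The absolute trace on subfields\<close>

lemma Tr_add: "Tr p d (x + y :: 'a) = Tr p d x + Tr p d y"
  by (simp add: Tr_def frob_add sum.distrib)

lemma Tr_diff: "Tr p d (x - y :: 'a) = Tr p d x - Tr p d y"
  by (simp add: Tr_def frob_diff sum_subtractf)

lemma Tr_mult: "a \<in> Fp \<Longrightarrow> Tr p d (a * x :: 'a) = a * Tr p d x"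
  by (simp add: Tr_def power_mult_distrib frob_Fp sum_distrib_left)

lemma Tr_power: "Tr p d ((x::'a) ^ (p ^ i)) = (Tr p d x) ^ (p ^ i)"
  by (simp add: Tr_def frob_sum frob_frob add.commute)

text \<open>The \<open>p\<close>-th power permutes the summands cyclically, so the trace is fixed by
  Frobenius.\<close>

lemma Tr_Fp: assumes "x \<in> K d" shows "Tr p d x \<in> Fp"
proof -
  have "Tr p d x ^ p = (\<Sum>i<d. x ^ (p ^ Suc i))"
    using frob_sum[of "\<lambda>i. x ^ (p ^ i)" "{..<d}" 1] by (simp add: Tr_def mult.commute flip: power_mult)
  also have "\<dots> = (\<Sum>i<Suc d. x ^ (p ^ i)) - x"
    by (subst sum.lessThan_Suc_shift) simp
  also have "\<dots> = Tr p d x"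
    using assms by (simp add: Tr_def K_def)
  finally show ?thesis by (simp add: K_def flip: K_1)
qed

lemma Tr_frob: "x \<in> K d \<Longrightarrow> Tr p d (x ^ (p ^ i)) = Tr p d x"
  by (simp add: Tr_power frob_Fp Tr_Fp)

text \<open>The conjugates of \<open>x\<close> repeat with period \<open>m\<close>, so the sum
  consists of \<open>l\<close> equal blocks.\<close>

lemma Tr_tower: assumes "x \<in> K m" shows "Tr p (m * l) x = of_nat l * Tr p m x"
proof (induction l)
  case (Suc l)
  have split: "(\<Sum>i<a+b. f i) = (\<Sum>i<a. f i) + (\<Sum>i<b. f (a + i))" for a b and f :: "nat \<Rightarrow> 'a"
    by (induction b) (simp_all add: add.assoc)
  have "Tr p (m * Suc l) x = Tr p (m * l) x + (\<Sum>i<m. x ^ (p ^ (m * l + i)))"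
    unfolding Tr_def mult_Suc_right by (subst add.commute) (rule split)
  also have "(\<Sum>i<m. x ^ (p ^ (m * l + i))) = Tr p m x"
    unfolding Tr_def by (simp add: K_frob_mult[OF assms] flip: frob_frob)
  finally show ?case using Suc by (simp add: algebra_simps)
qed (simp add: Tr_def)

text \<open>If \<open>M\<close> were nonzero, its multiples would fill \<open>K d\<close> and the
  trace would vanish there, giving a polynomial of degree \<open>p ^ (d - 1)\<close> too many
  roots.\<close>

lemma Tr_nondegenerate:
  assumes card: "card (K d) = p ^ d" "d > 0" and M: "M \<in> K d" "\<And>y. y \<in> K d \<Longrightarrow> Tr p d (y * M) = 0"
  shows "M = 0"
proof (rule ccontr)
  assume "M \<noteq> 0"
  have "Tr p d w = 0" if "w \<in> K d" for w
    using M(2)[of "w / M"] K_divide[OF that M(1)] \<open>M \<noteq> 0\<close> by simp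
  then have "K d \<subseteq> {x. (\<Sum>i<d. x ^ (p ^ i)) = 0}" by (auto simp: Tr_def)
  then have "card (K d) \<le> card {x::'a. (\<Sum>i<d. x ^ (p ^ i)) = 0}" by (intro card_mono) auto
  also have "\<dots> \<le> p ^ (d - 1)" using card_power_sum_fibre_le[of p d "0::'a"] p_gt_2 card(2) by simp
  also have "\<dots> < p ^ d" using p_gt_2 card(2) by (intro power_strict_increasing) auto
  finally show False using card by simp
qed

section \<open>The given forms over every subfield, and their radicals\<close>

definition form :: "nat \<Rightarrow> 'a \<Rightarrow> nat \<Rightarrow> nat \<Rightarrow> 'a \<Rightarrow> 'a" where
  "form d c r t x = c * Tr p d (x ^ (p ^ r + 1) - x ^ (p ^ t + 1))"

definition polar :: "nat \<Rightarrow> 'a \<Rightarrow> nat \<Rightarrow> nat \<Rightarrow> 'a \<Rightarrow> 'a \<Rightarrow> 'a" where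
  "polar d c r t x z = c * Tr p d (x ^ (p ^ r) * z + x * z ^ (p ^ r) - x ^ (p ^ t) * z - x * z ^ (p ^ t))"

lemma quadratic_form:
  assumes c: "c \<in> Fp"
  shows "quadratic (K d) (form d c r t) (polar d c r t)"
  unfolding quadratic_def linear_Fp_def
proof (intro conjI ballI)
  show "subspace_Fp (K d)" by (rule subspace_K)
next
  fix x assume "x \<in> K d"
  then show "form d c r t x \<in> Fp"
    unfolding form_def by (intro mult_Fp c Tr_Fp K_diff K_power)
next
  fix x y assume "x \<in> K d" "y \<in> K d"
  have "(x + y) ^ (p ^ r + 1) - (x + y) ^ (p ^ t + 1) =
      (x ^ (p ^ r + 1) - x ^ (p ^ t + 1)) + (y ^ (p ^ r + 1) - y ^ (p ^ t + 1)) +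
      (x ^ (p ^ r) * y + x * y ^ (p ^ r) - x ^ (p ^ t) * y - x * y ^ (p ^ t))"
    by (simp add: frob_add algebra_simps)
  then show "form d c r t (x + y) = form d c r t x + form d c r t y + polar d c r t x y"
    unfolding form_def polar_def by (simp only: Tr_add ring_distribs)
next
  fix a x assume a: "a \<in> Fp" "x \<in> K d"
  have "(a * x) ^ (p ^ r + 1) - (a * x) ^ (p ^ t + 1) = a\<^sup>2 * (x ^ (p ^ r + 1) - x ^ (p ^ t + 1))"
    using a by (simp add: power_mult_distrib frob_Fp power2_eq_square algebra_simps)
  then show "form d c r t (a * x) = a\<^sup>2 * form d c r t x"
    unfolding form_def using a by (simp only: Tr_mult power_Fp mult.left_commute)
next
  fix x y assume "x \<in> K d" "y \<in> K d"
  then show "polar d c r t x y \<in> Fp"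
    unfolding polar_def by (intro mult_Fp c Tr_Fp K_diff K_add K_mult K_power)
next
  fix x y z assume "x \<in> K d" "y \<in> K d" "z \<in> K d"
  have "(x + y) ^ (p ^ r) * z + (x + y) * z ^ (p ^ r) - (x + y) ^ (p ^ t) * z - (x + y) * z ^ (p ^ t) =
      (x ^ (p ^ r) * z + x * z ^ (p ^ r) - x ^ (p ^ t) * z - x * z ^ (p ^ t)) +
      (y ^ (p ^ r) * z + y * z ^ (p ^ r) - y ^ (p ^ t) * z - y * z ^ (p ^ t))"
    by (simp add: frob_add algebra_simps)
  then show "polar d c r t (x + y) z = polar d c r t x z + polar d c r t y z"
    unfolding polar_def by (simp only: Tr_add ring_distribs)
next
  fix a x y assume a: "a \<in> Fp" "x \<in> K d" "y \<in> K d"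
  have "(a * x) ^ (p ^ r) * y + (a * x) * y ^ (p ^ r) - (a * x) ^ (p ^ t) * y - (a * x) * y ^ (p ^ t) =
      a * (x ^ (p ^ r) * y + x * y ^ (p ^ r) - x ^ (p ^ t) * y - x * y ^ (p ^ t))"
    using a by (simp add: power_mult_distrib frob_Fp algebra_simps)
  then show "polar d c r t (a * x) y = a * polar d c r t x y"
    unfolding polar_def using a by (simp only: Tr_mult mult.left_commute)
qed

text \<open>Each term may be raised to a power of Frobenius under the trace. Doing so until
  \<open>x ^ (p ^ r)\<close> is a common factor leaves a linearized polynomial in
  \<open>z\<close>.\<close>

lemma polar_eq:
  assumes x: "x \<in> K d" and z: "z \<in> K d" and "t < r"
  shows "polar d c r t x z =
    c * Tr p d (x ^ (p ^ r) * (z + z ^ (p ^ (2 * r)) - z ^ (p ^ (r - t)) - z ^ (p ^ (r + t))))"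
proof -
  have e1: "Tr p d (x * z ^ (p ^ r)) = Tr p d (x ^ (p ^ r) * z ^ (p ^ (2 * r)))"
    using Tr_frob[OF K_mult[OF x K_power[OF z]], of "p ^ r" r]
    by (simp add: power_mult_distrib frob_frob mult_2)
  have e2: "Tr p d (x ^ (p ^ t) * z) = Tr p d (x ^ (p ^ r) * z ^ (p ^ (r - t)))"
    using Tr_frob[OF K_mult[OF K_power[OF x] z], of "p ^ t" "r - t"] assms(3)
    by (simp add: power_mult_distrib frob_frob)
  have e3: "Tr p d (x * z ^ (p ^ t)) = Tr p d (x ^ (p ^ r) * z ^ (p ^ (r + t)))"
    using Tr_frob[OF K_mult[OF x K_power[OF z]], of "p ^ t" r]
    by (simp add: power_mult_distrib frob_frob add.commute)
  show ?thesis
    unfolding polar_def by (simp only: Tr_add Tr_diff e1 e2 e3 distrib_left right_diff_distrib)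
qed

text \<open>With \<open>\<sigma>\<close> the Frobenius map, the linearized polynomial of
  \<open>polar_eq\<close> is \<open>(\<sigma>^(r-t) - 1) (\<sigma>^(r+t) - 1)\<close>. The gcd
  conditions make the kernel of each factor on \<open>K d\<close> equal to \<open>Fp\<close>, and
  \<open>coprime d p\<close> keeps the kernel of the product from being larger.\<close>

lemma radical_polar:
  assumes card: "card (K d) = p ^ d" "d > 0" "coprime d p"
    and c: "c \<in> Fp" "c \<noteq> 0" and rt: "t < r" "gcd d (r + t) = 1" "gcd d (r - t) = 1"
  shows "radical (K d) (polar d c r t) = Fp"
proof (intro equalityI subsetI)
  fix z assume "z \<in> radical (K d) (polar d c r t)"
  then have z: "z \<in> K d" "\<And>y. y \<in> K d \<Longrightarrow> polar d c r t y z = 0"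
    by (auto simp: radical_def)
  define M where "M = z + z ^ (p ^ (2 * r)) - z ^ (p ^ (r - t)) - z ^ (p ^ (r + t))"
  \<comment> \<open>As Frobenius is bijective on \<open>K d\<close>, the factor
    \<open>y ^ (p ^ r)\<close> runs through all of \<open>K d\<close> and nondegeneracy yields
    \<open>M = 0\<close>.\<close>
  have im: "(\<lambda>x. x ^ (p ^ r)) ` K d = K d"
    by (rule endo_inj_surj) (auto intro: K_power inj_onI frob_inj)
  have "Tr p d (y ^ (p ^ r) * M) = 0" if "y \<in> K d" for y
    using polar_eq[OF that z(1) rt(1), of c] z(2)[OF that] c(2) by (simp add: M_def)
  then have "Tr p d (y * M) = 0" if "y \<in> (\<lambda>x. x ^ (p ^ r)) ` K d" for y
    using that by blast
  then have "Tr p d (y * M) = 0" if "y \<in> K d" for y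
    using that unfolding im .
  moreover have "M \<in> K d" unfolding M_def by (intro K_add K_diff K_power z)
  ultimately have "M = 0" using Tr_nondegenerate card by blast
  define u where "u = z ^ (p ^ (r + t)) - z"
  have "u ^ (p ^ (r - t)) - u = M"
  proof -
    have e: "r + t + (r - t) = 2 * r" using rt(1) by simp
    show ?thesis unfolding u_def M_def frob_diff frob_frob e by (simp add: algebra_simps)
  qed
  then have "u \<in> K (r - t)" using \<open>M = 0\<close> by (simp add: K_def)
  moreover have "u \<in> K d" unfolding u_def by (intro K_diff K_power z)
  ultimately have u: "u \<in> Fp" using K_gcd[of u d "r - t"] rt K_1 by simp
  \<comment> \<open>Since \<open>u\<close> lies in \<open>Fp\<close>, each application of the second
    factor's Frobenius power adds \<open>u\<close>. After \<open>d\<close> applications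
    \<open>z\<close> is back, so \<open>d * u = 0\<close>.\<close>
  have "z ^ (p ^ ((r + t) * i)) = z + of_nat i * u" for i
  proof (induction i)
    case (Suc i)
    have "z ^ (p ^ ((r + t) * Suc i)) = (z ^ (p ^ ((r + t) * i))) ^ (p ^ (r + t))"
      by (simp add: frob_frob add.commute)
    also have "\<dots> = z ^ (p ^ (r + t)) + of_nat i * u"
      unfolding Suc by (simp only: frob_add frob_Fp[OF mult_Fp[OF of_nat_Fp u]])
    also have "\<dots> = z + of_nat (Suc i) * u" by (simp add: u_def algebra_simps)
    finally show ?case .
  qed simp
  from this[of d] have "of_nat d * u = 0"
    using K_frob_mult[OF z(1), of "r + t"] by (simp add: mult.commute)
  moreover have "\<not> p dvd d"
    using coprime_common_divisor[OF card(3), of p] p_gt_2 by auto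
  ultimately have "u = 0" by (simp add: of_nat_eq_0)
  then have "z \<in> K (r + t)" by (simp add: u_def K_def)
  then show "z \<in> Fp" using K_gcd[OF z(1), of "r + t"] rt K_1 by simp
next
  fix z assume z: "z \<in> Fp"
  then have "z \<in> K d" using Fp_subset_K by blast
  then show "z \<in> radical (K d) (polar d c r t)"
    using polar_eq[of _ d z t r c] rt(1) frob_Fp[OF z] p_gt_2 by (simp add: radical_def Tr_def zero_power)
qed

text \<open>The integer value of the exponential sum over \<open>K d\<close>, as in
  \<open>gsum_eq_level_diff\<close>. Writing it with level sizes makes it accessible to counting
  modulo \<open>l\<close>.\<close>

definition sgn_sum :: "nat \<Rightarrow> 'a \<Rightarrow> nat \<Rightarrow> nat \<Rightarrow> int" where
  "sgn_sum d c r t = int (level (K d) (form d c r t) 0) - int (level (K d) (form d c r t) 1)"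

text \<open>The map \<open>x \<mapsto> x ^ (p ^ m)\<close> preserves the level set over
  \<open>K (m * l)\<close>, and its \<open>l\<close>-th iterate is the identity there. Its fixed
  points lie in \<open>K m\<close>, where the trace picks up a factor \<open>l\<close> that moves
  into the coefficient.\<close>

lemma level_cong:
  assumes l: "prime l"
  shows "[level (K (m * l)) (form (m * l) c r t) i = level (K m) (form m (of_nat l * c) r t) i] (mod l)"
proof -
  let ?d = "m * l" and ?f = "\<lambda>x::'a. x ^ (p ^ m)"
  let ?A = "{x \<in> K ?d. form ?d c r t x = i}"
  have sub: "x \<in> K ?d" if "x \<in> K m" for x using K_frob_mult[OF that] by (simp add: K_def)
  have inv: "form ?d c r t (?f x) = form ?d c r t x" if "x \<in> K ?d" for x
  proof -
    have "?f x ^ (p ^ r + 1) - ?f x ^ (p ^ t + 1) = ?f (x ^ (p ^ r + 1) - x ^ (p ^ t + 1))"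
      unfolding frob_diff by (simp only: flip: power_mult) (simp only: mult.commute)
    then show ?thesis
      unfolding form_def using that by (simp only: Tr_frob K_diff K_power)
  qed
  have tower: "form ?d c r t x = form m (of_nat l * c) r t x" if "x \<in> K m" for x
    unfolding form_def Tr_tower[OF K_diff[OF K_power[OF that] K_power[OF that]]]
    by (simp only: mult_ac)
  have "[card ?A = card {x\<in>?A. ?f x = x}] (mod l)"
  proof (rule cong_card_fixed_points[OF l])
    show "?f ` ?A \<subseteq> ?A" using inv K_power by auto
    fix x assume "x \<in> ?A"
    have "(?f ^^ k) x = x ^ (p ^ (m * k))" for k
      by (induction k) (auto simp: frob_frob add.commute)
    then show "(?f ^^ l) x = x" using \<open>x \<in> ?A\<close> by (simp add: K_def)
  qed simp
  also have "{x\<in>?A. ?f x = x} = {x \<in> K m. form ?d c r t x = i}"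
    using sub by (auto simp: K_def)
  also have "\<dots> = {x \<in> K m. form m (of_nat l * c) r t x = i}"
    using tower by auto
  finally show ?thesis by (simp add: level_def)
qed

context
  fixes n :: nat
  assumes card_UNIV: "CARD('a) = p ^ n" and odd_n: "odd n" and coprime_n: "coprime n p"
begin

text \<open>Oddness and coprimality to \<open>p\<close> pass from \<open>n\<close> to
  \<open>d\<close>, so the radical over \<open>K d\<close> is \<open>Fp\<close> and
  \<open>gsum_eq_level_diff\<close> applies to every intermediate field.\<close>

lemma sgn_sum_spec:
  assumes "d dvd n" "c \<in> Fp" "c \<noteq> 0" "t < r" "gcd d (r + t) = 1" "gcd d (r - t) = 1"
  shows "gsum (K d) (form d c r t) 1 = of_int (sgn_sum d c r t)"
    and "(sgn_sum d c r t)\<^sup>2 = int p ^ (d + 1)"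
proof -
  have d: "odd d" "coprime d p"
    using assms(1) odd_n dvd_trans coprime_divisors[OF assms(1) dvd_refl coprime_n] by blast+
  then have "d > 0" by (simp add: odd_pos)
  have V: "card (K d) = p ^ d" using card_K[OF card_UNIV assms(1)] odd_n by (simp add: odd_pos)
  have R: "card (radical (K d) (polar d c r t)) = p"
    using radical_polar[OF V \<open>d > 0\<close> d(2) assms(2-6)] card_Fp by simp
  show "gsum (K d) (form d c r t) 1 = of_int (sgn_sum d c r t)"
    and "(sgn_sum d c r t)\<^sup>2 = int p ^ (d + 1)"
    unfolding sgn_sum_def using gsum_eq_level_diff[OF quadratic_form[OF assms(2)] V d(1) R] by auto
qed

text \<open>The induction leaves \<open>c\<close> and \<open>c'\<close> arbitrary because each
  descent to a subfield multiplies them by a prime.\<close>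

lemma sgn_sum_unique:
  assumes "d dvd n" "c \<in> Fp" "c \<noteq> 0" "t < r" "gcd d (r + t) = 1" "gcd d (r - t) = 1"
    and "c' \<in> Fp" "c' \<noteq> 0" "t' < r'" "gcd d (r' + t') = 1" "gcd d (r' - t') = 1"
  shows "sgn_sum d c r t = sgn_sum d c' r' t'"
  using assms
proof (induction d arbitrary: c c' rule: less_induct)
  case (less d)
  have "d > 0" using less.prems(1) odd_n by (cases "d = 0") auto
  show ?case
  proof (cases "d = 1")
    case True
    \<comment> \<open>On the prime field both terms of the form equal \<open>x\<^sup>2\<close> and
      cancel.\<close>
    have "form 1 a s u x = 0" if "x \<in> Fp" for a s u x
      using that by (simp add: form_def Tr_def frob_Fp)
    then have lev: "level Fp (form 1 a s u) i = card {x\<in>Fp. 0 = i}" for a s u i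
      unfolding level_def by (intro arg_cong[of _ _ card]) auto
    show ?thesis unfolding True sgn_sum_def K_1 lev ..
  next
    case False
    then obtain l where l: "prime l" "l dvd d" using prime_factor_nat by blast
    then obtain m where m: "d = m * l" by (auto simp: mult.commute elim: dvdE)
    have ln: "l dvd n" using l(2) less.prems(1) dvd_trans by blast
    have "l \<noteq> p"
      using coprime_common_divisor[OF coprime_n, of p] ln p_gt_2 by auto
    then have "\<not> p dvd l" using l(1) prime_p primes_dvd_imp_eq by blast
    then have l0: "(of_nat l :: 'a) \<noteq> 0" by (simp add: of_nat_eq_0)
    have "l \<noteq> 2" using ln odd_n by auto
    have step: "[sgn_sum d a s u = sgn_sum m (of_nat l * a) s u] (mod int l)" for a s u
      unfolding sgn_sum_def m by (intro cong_diff cong_int_iff[THEN iffD2] level_cong[OF l(1)])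
    have gcd_m: "gcd m k = 1" if "gcd d k = 1" for k
    proof -
      have "gcd m k dvd gcd d k" unfolding m by (intro gcd_greatest) (auto intro: dvd_mult2)
      then show ?thesis using that by simp
    qed
    \<comment> \<open>The new coefficients remain nonzero because \<open>l \<noteq> p\<close>, and
      the gcd conditions pass to the divisor \<open>m\<close>.\<close>
    have "sgn_sum m (of_nat l * c) r t = sgn_sum m (of_nat l * c') r' t'"
    proof (rule less.IH)
      show "m < d" using m l(1) \<open>d > 0\<close> prime_gt_1_nat by simp
      show "m dvd n" using less.prems(1) unfolding m by (rule dvd_mult_left)
    qed (use less.prems l0 gcd_m in \<open>auto intro: mult_Fp\<close>)
    then have "[sgn_sum d c r t = sgn_sum d c' r' t'] (mod int l)"
      using step[of c r t] step[of c' r' t'] by (simp add: cong_def)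
    then have dvd: "int l dvd sgn_sum d c r t - sgn_sum d c' r' t'" by (simp add: cong_iff_dvd_diff)
    note sq = sgn_sum_spec(2)[OF less.prems(1-6)] sgn_sum_spec(2)[OF less.prems(1,7-11)]
    \<comment> \<open>Opposite values would make the odd prime \<open>l\<close> divide one of them,
      hence its square \<open>p ^ (d + 1)\<close>.\<close>
    have "sgn_sum d c r t \<noteq> - sgn_sum d c' r' t'"
    proof
      assume "sgn_sum d c r t = - sgn_sum d c' r' t'"
      then have "int l dvd 2 * sgn_sum d c r t" using dvd by simp
      moreover have "\<not> int l dvd 2"
        using \<open>l \<noteq> 2\<close> primes_dvd_imp_eq[OF l(1) two_is_prime_nat] int_dvd_int_iff[of l 2] by auto
      moreover have pl: "prime (int l)" using l(1) by simp
      ultimately have "int l dvd sgn_sum d c r t" using prime_dvd_mult_iff by blast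
      then have "int l dvd (sgn_sum d c r t)\<^sup>2" by (simp add: power2_eq_square)
      then have "int l dvd int p ^ (d + 1)" unfolding sq .
      then have "int l dvd int p" using pl prime_dvd_power by blast
      then have "l dvd p" by (simp only: int_dvd_int_iff)
      then show False using \<open>l \<noteq> p\<close> primes_dvd_imp_eq[OF l(1) prime_p] by blast
    qed
    moreover have "(sgn_sum d c r t)\<^sup>2 = (sgn_sum d c' r' t')\<^sup>2" using sq by simp
    ultimately show ?thesis by (simp add: power2_eq_iff)
  qed
qed

end

end

section \<open>Interpolated families\<close>

context odd_char
begin

text \<open>The factors run through the nonzero elements of \<open>Fp\<close>, whose product is
  \<open>-1\<close> by Wilson's theorem.\<close>

lemma prod_of_nat_diff:
  assumes "k < p"
  shows "(\<Prod>j\<in>{j. j < p \<and> j \<noteq> k}. (of_nat k - of_nat j :: 'a)) = - 1"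
proof -
  have p: "p > 0" using p_gt_2 by simp
  have Fp0: "Fp - {0} = of_nat ` {1..p-1}"
  proof -
    have "{..<p} = insert 0 {1..p-1}" using p by auto
    moreover have "(of_nat i :: 'a) \<noteq> 0" if "i \<in> {1..p-1}" for i
      using that p by (auto simp: of_nat_eq_0 dest: dvd_imp_le)
    ultimately show ?thesis by (auto simp: Fp_eq)
  qed
  have inj: "inj_on (\<lambda>j. of_nat k - of_nat j :: 'a) {j. j < p \<and> j \<noteq> k}"
    by (auto simp: inj_on_def of_nat_eq)
  have "(\<lambda>j. of_nat k - of_nat j :: 'a) ` {j. j < p \<and> j \<noteq> k} = Fp - {0}"
  proof (rule card_seteq)
    show "(\<lambda>j. of_nat k - of_nat j :: 'a) ` {j. j < p \<and> j \<noteq> k} \<subseteq> Fp - {0}"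
      using assms by (auto intro: diff_Fp simp: of_nat_eq)
    have "{j. j < p \<and> j \<noteq> k} = {..<p} - {k}" by auto
    then show "card (Fp - {0}) \<le> card ((\<lambda>j. of_nat k - of_nat j :: 'a) ` {j. j < p \<and> j \<noteq> k})"
      unfolding card_image[OF inj] using assms by (simp add: card_Fp)
  qed simp
  then have "(\<Prod>j\<in>{j. j < p \<and> j \<noteq> k}. (of_nat k - of_nat j :: 'a)) = \<Prod>(Fp - {0})"
    using prod.reindex[OF inj, of "\<lambda>x. x"] by simp
  also have "\<dots> = (\<Prod>i=1..p-1. of_nat i)"
  proof -
    have "inj_on (of_nat :: nat \<Rightarrow> 'a) {1..p-1}"
      by (rule inj_on_subset[OF inj_on_of_nat]) (use p in auto)
    from prod.reindex[OF this, of "\<lambda>x. x"] show ?thesis unfolding Fp0 by simp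
  qed
  also have "\<dots> = of_nat (fact (p - 1))" by (simp add: fact_prod)
  also have "\<dots> = - 1"
  proof -
    have "int p dvd fact (p - 1) - (- 1)"
      using wilson_theorem[OF prime_p] by (simp add: cong_iff_dvd_diff)
    also have "(fact (p - 1) - (- 1) :: int) = int (fact (p - 1) + 1)" by simp
    finally have "p dvd fact (p - 1) + 1" by (simp only: int_dvd_int_iff)
    then have "(of_nat (fact (p - 1) + 1) :: 'a) = 0" by (simp only: of_nat_eq_0)
    then show ?thesis by (simp add: eq_neg_iff_add_eq_0 add.commute)
  qed
  finally show ?thesis .
qed

text \<open>At \<open>y\<close> only the summand \<open>k = y\<close> survives, with product
  \<open>-1\<close>; the outer factor is \<open>-1\<close> in characteristic
  \<open>p\<close>.\<close>

lemma interpolation: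
  fixes f :: "nat \<Rightarrow> 'a"
  assumes "y < p"
  shows "(of_nat p - 1) * (\<Sum>k<p. (\<Prod>j\<in>{j. j < p \<and> j \<noteq> k}. (of_nat y - of_nat j)) * f k) = f y"
proof -
  have "(\<Prod>j\<in>{j. j < p \<and> j \<noteq> k}. (of_nat y - of_nat j :: 'a)) = 0" if "k < p" "k \<noteq> y" for k
    using that assms by (intro prod_zero) auto
  then have "(\<Sum>k<p. (\<Prod>j\<in>{j. j < p \<and> j \<noteq> k}. (of_nat y - of_nat j)) * f k) =
      (\<Sum>k<p. if k = y then - f y else 0)"
    using prod_of_nat_diff[OF assms] by (intro sum.cong) auto
  then show ?thesis using assms by simp
qed

text \<open>One integer \<open>D\<close> for all \<open>(a, b)\<close> fixes the sign: the required
  \<open>\<zeta>\<close> is \<open>D\<close> divided by its absolute value.\<close>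

lemma weakly_regular_bentI:
  fixes F :: "'a \<Rightarrow> 'a \<Rightarrow> 'a" and D :: int
  assumes D: "D\<^sup>2 = int p ^ (n + 1)"
    and F: "\<And>a b. b < p \<Longrightarrow> \<exists>s\<in>Fp. walsh p n F a b = ch s * of_int D"
  shows "weakly_regular_bent p n F"
proof -
  define q where "q = sqrt (real p) ^ (n + 1)"
  have q: "q > 0" using p_gt_2 by (simp add: q_def)
  have D': "(real_of_int D)\<^sup>2 = real p ^ (n + 1)"
    using arg_cong[OF D, of real_of_int] by simp
  have "q\<^sup>2 = ((sqrt (real p))\<^sup>2) ^ (n + 1)"
    unfolding q_def by (simp only: mult.commute flip: power_mult)
  then have "(real_of_int D)\<^sup>2 = q\<^sup>2" using D' by simp
  then have Dq: "\<bar>real_of_int D\<bar> = q" using q by (auto simp: power2_eq_iff)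
  \<comment> \<open>The condition on \<open>b\<close> sits under the existential so that choice
    gives a total function, unconstrained for \<open>b \<ge> p\<close>.\<close>
  have "\<forall>a b. \<exists>s. b < p \<longrightarrow> s < p \<and> walsh p n F a b = eps p (int s) * of_int D"
    using F fp_val_less unfolding ch_def by metis
  then obtain Fs where Fs: "\<And>a b. b < p \<Longrightarrow> Fs a b < p"
    "\<And>a b. b < p \<Longrightarrow> walsh p n F a b = eps p (int (Fs a b)) * of_int D" by metis
  have "is_bent p n F"
    unfolding is_bent_def
  proof (intro allI impI)
    fix a b assume "b < p"
    then have "cmod (walsh p n F a b) = \<bar>real_of_int D\<bar>"
      using Fs(2) by (simp add: norm_mult eps_def)
    then show "(cmod (walsh p n F a b))\<^sup>2 = real p ^ (n + 1)"
      using D' by simp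
  qed
  moreover have "cmod (of_int D / of_real q) = 1"
    using q Dq by (simp add: norm_divide)
  moreover have "walsh p n F a b / of_real q = of_int D / of_real q * eps p (int (Fs a b))" if "b < p" for a b
    using Fs(2)[OF that] by simp
  ultimately show ?thesis
    unfolding weakly_regular_bent_def q_def using Fs(1) by blast
qed

lemma weakly_regular_bent_of_forms:
  fixes n :: nat and c r t :: "nat \<Rightarrow> nat" and bb :: "nat \<Rightarrow> 'a"
  assumes n: "CARD('a) = p ^ n" "odd n" "gcd n p = 1"
    and c: "\<forall>k<p. 0 < c k \<and> c k < p"
    and rt: "\<forall>k<p. t k < r k \<and> gcd n (r k + t k) = 1 \<and> gcd n (r k - t k) = 1"
    and g_def: "g = (\<lambda>k (x::'a). of_nat (c k) * Tr p n (x ^ (p ^ r k + 1) - x ^ (p ^ t k + 1)))"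
    and tr: "\<forall>k<p. g k 1 + Tr p n (bb k) = g 0 1 + of_nat k"
    and F_def: "F = (\<lambda>x y. (of_nat p - 1) *
           (\<Sum>k<p. (\<Prod>j\<in>{j. j < p \<and> j \<noteq> k}. (y - of_nat j)) * (g k x + Tr p n (bb k * x))))"
  shows "(\<forall>x. \<forall>y<p. F x (of_nat y) \<in> range of_nat) \<and> weakly_regular_bent p n F"
proof -
  have cop: "coprime n p" using n(3) by (rule gcd_eq_1_imp_coprime)
  have "n > 0" using n(2) by (simp add: odd_pos)
  have UNIV_K: "K n = (UNIV :: 'a set)"
    using finite_field_power_card[where 'a = 'a] n(1) by (auto simp: K_def)
  have cardK: "card (K n) = p ^ n" using UNIV_K n(1) by simp
  have g: "g k = form n (of_nat (c k)) (r k) (t k)" for k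
    by (simp add: g_def form_def fun_eq_iff)
  \<comment> \<open>The two monomials agree at \<open>1\<close>, so the condition on
    \<open>bb\<close> becomes \<open>Tr(bb k) = k\<close>.\<close>
  have "g k 1 = 0" for k using p_gt_2 by (simp add: g_def Tr_def zero_power)
  then have bb: "Tr p n (bb k) = of_nat k" if "k < p" for k using tr that by simp
  have valid: "of_nat (c k) \<in> Fp" "of_nat (c k) \<noteq> (0::'a)" "t k < r k"
    "gcd n (r k + t k) = 1" "gcd n (r k - t k) = 1" if "k < p" for k
    using c rt that dvd_imp_le[of p "c k"] by (auto simp: of_nat_eq_0 leD)
  have TrF: "Tr p n x \<in> Fp" for x :: 'a using Tr_Fp[of x n] UNIV_K by simp
  have quad: "quadratic UNIV (g k) (polar n (of_nat (c k)) (r k) (t k))" if "k < p" for k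
    using quadratic_form[OF valid(1)[OF that], of n] by (simp add: g UNIV_K)
  have rad: "radical UNIV (polar n (of_nat (c k)) (r k) (t k)) = Fp" if "k < p" for k
    using radical_polar[OF cardK \<open>n > 0\<close> cop valid[OF that]] by (simp add: UNIV_K)
  define D where "D = sgn_sum n (of_nat (c 0)) (r 0) (t 0)"
  have "p > 0" using p_gt_2 by simp
  have D: "D\<^sup>2 = int p ^ (n + 1)"
    unfolding D_def by (rule sgn_sum_spec(2)[OF n(1,2) cop dvd_refl valid[OF \<open>p > 0\<close>]])
  have W0: "W UNIV (g k) (\<lambda>_. 0) = of_int D" if "k < p" for k
    using sgn_sum_spec(1)[OF n(1,2) cop dvd_refl valid[OF that]]
      sgn_sum_unique[OF n(1,2) cop dvd_refl valid[OF that] valid[OF \<open>p > 0\<close>]]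
    by (simp add: W_def gsum_def D_def g UNIV_K)
  have F_eq: "F x (of_nat y) = g y x + Tr p n (bb y * x)" if "y < p" for x y
    unfolding F_def by (rule interpolation[OF that])
  have gF: "g k x \<in> Fp" if "k < p" for k x
    using quadratic_Fp[OF quad[OF that]] by simp
  have "F x (of_nat y) \<in> range of_nat" if "y < p" for x y
    using add_Fp[OF gF[OF that] TrF] F_eq[OF that] by (simp add: Fp_def)
  moreover have "weakly_regular_bent p n F"
  proof (rule weakly_regular_bentI[OF D])
    fix a :: 'a and b :: nat assume "b < p"
    \<comment> \<open>For fixed \<open>y\<close> the Walsh exponent is \<open>g y x - l y x\<close>
      up to a constant. On the radical \<open>Fp\<close> the functional \<open>l y\<close> is
      multiplication by \<open>Tr(a) - y\<close>, so it vanishes there only for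
      \<open>y = y0\<close>.\<close>
    define l where "l y x = Tr p n ((a - bb y) * x)" for y x
    define y0 where "y0 = fp_val p (Tr p n a)"
    have y0: "y0 < p" "of_nat y0 = Tr p n a"
      using fp_val_less[OF TrF] of_nat_fp_val[OF TrF] by (simp_all add: y0_def)
    have lin: "linear_Fp UNIV (l y)" for y
      by (simp add: linear_Fp_def l_def TrF Tr_add distrib_left)
    have l_Fp: "l y z = z * (Tr p n a - of_nat y)" if "z \<in> Fp" "y < p" for y z
      using Tr_mult[OF that(1), of n "a - bb y"] bb[OF that(2)]
      by (simp add: l_def Tr_diff mult.commute)
    have summand: "ch (F x (of_nat y) - Tr p n (a * x) - of_nat b * of_nat y) =
        ch (- (of_nat b * of_nat y)) * ch (g y x - l y x)" if "y < p" for x y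
    proof -
      have lF: "l y x \<in> Fp" by (simp add: l_def TrF)
      have eq: "F x (of_nat y) - Tr p n (a * x) - of_nat b * of_nat y =
          - (of_nat b * of_nat y) + (g y x - l y x)"
        using F_eq[OF that] by (simp add: l_def left_diff_distrib Tr_diff)
      show ?thesis
        unfolding eq by (intro ch_add uminus_Fp mult_Fp diff_Fp of_nat_Fp gF[OF that] lF)
    qed
    have "walsh p n F a b = (\<Sum>x\<in>UNIV. \<Sum>y<p. ch (- (of_nat b * of_nat y)) * ch (g y x - l y x))"
      unfolding walsh_def using summand by (intro sum.cong refl) (simp add: ch_def)
    also have "\<dots> = (\<Sum>y<p. ch (- (of_nat b * of_nat y)) * W UNIV (g y) (l y))"
      by (subst sum.swap) (simp add: W_def sum_distrib_left)
    also have "\<dots> = (\<Sum>y<p. if y = y0 then ch (- (of_nat b * of_nat y0)) * W UNIV (g y0) (l y0) else 0)"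
    proof (rule sum.cong)
      fix y assume "y \<in> {..<p}"
      then have y: "y < p" by simp
      have "W UNIV (g y) (l y) = 0" if "y \<noteq> y0"
      proof (rule W_eq_0[OF quad[OF y] lin, of 1])
        show "l y 1 \<noteq> 0"
          using l_Fp[OF one_Fp y] that y y0 of_nat_eq[of y y0] by simp
      qed (simp add: rad[OF y])
      then show "ch (- (of_nat b * of_nat y)) * W UNIV (g y) (l y) =
          (if y = y0 then ch (- (of_nat b * of_nat y0)) * W UNIV (g y0) (l y0) else 0)" by simp
    qed simp
    also have "\<dots> = ch (- (of_nat b * of_nat y0)) * W UNIV (g y0) (l y0)"
      using y0(1) by simp
    finally have walsh: "walsh p n F a b = ch (- (of_nat b * of_nat y0)) * W UNIV (g y0) (l y0)" .
    \<comment> \<open>For the surviving index the functional is trivial on the radical, so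
      completing the square applies.\<close>
    obtain z where z: "W UNIV (g y0) (l y0) = ch (- g y0 z) * W UNIV (g y0) (\<lambda>_. 0)"
      by (rule W_complete_square[OF quad[OF y0(1)] lin, of y0])
        (use l_Fp y0 rad in auto)
    have mem: "- (of_nat b * of_nat y0) \<in> Fp" "- g y0 z \<in> Fp"
      by (intro uminus_Fp mult_Fp of_nat_Fp gF[OF y0(1)])+
    have "walsh p n F a b = ch (- (of_nat b * of_nat y0) + - g y0 z) * of_int D"
      unfolding walsh z W0[OF y0(1)] by (simp only: ch_add[OF mem] mult.assoc)
    then show "\<exists>s\<in>Fp. walsh p n F a b = ch s * of_int D"
      using add_Fp[OF mem] by blast
  qed
  ultimately show ?thesis by blast
qed

end

theorem theorem8:
  fixes p n :: nat
    and c :: "nat \<Rightarrow> nat"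
    and r t :: "nat \<Rightarrow> nat"
    and bb :: "nat \<Rightarrow> 'a::{field,finite}"
  assumes "prime p" and "odd p" and "odd n"
    and "CARD('a) = p ^ n" and "CHAR('a) = p"
    and "\<forall>k<p. 0 < c k \<and> c k < p"
    and "\<forall>k<p. t k < r k \<and> gcd n (r k + t k) = 1 \<and> gcd n (r k - t k) = 1"
    and "gcd n p = 1"
  defines "g \<equiv> (\<lambda>k (x::'a). of_nat (c k) * Tr p n (x ^ (p ^ r k + 1) - x ^ (p ^ t k + 1)))"
  assumes "\<forall>k<p. g k 1 + Tr p n (bb k) = g 0 1 + of_nat k"
  defines "F \<equiv> (\<lambda>x y. (of_nat p - 1) *
           (\<Sum>k<p. (\<Prod>j\<in>{j. j < p \<and> j \<noteq> k}. (y - of_nat j)) * (g k x + Tr p n (bb k * x))))"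
  shows "(\<forall>x. \<forall>y<p. F x (of_nat y) \<in> range of_nat) \<and> weakly_regular_bent p n F"
proof -
  have "odd_char TYPE('a) p" by (rule odd_char.intro) (fact assms)+
  from odd_char.weakly_regular_bent_of_forms[OF this assms(4,3,8,6,7)
      meta_eq_to_obj_eq[OF g_def] assms(10) meta_eq_to_obj_eq[OF F_def]]
  show ?thesis .
qed

end
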